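(* The infinite dihedral group does not have Borel's property, and therefore no group containing infinitely many elements of order $2$, such as a non-oriented Fuchsian group or an oriented Fuchsian group with an elliptic point of order $2$, can have Borel's property.
   Context: A group $\Gamma$ has Borel's property if for every connected semisimple linear algebraic group $G$ over $\mathbb{C}$, every proper (Zariski-closed) subvariety $V$ of $G$, and every nontorsion element $\gamma\ne 1$ in $\Gamma$ (i.e., every element of infinite order), there exists a homomorphism $\phi\colon\Gamma\to G(\mathbb{C})$ such that $\phi(\gamma)\notin V(\mathbb{C})$. A Fuchsian group is a discrete group of isometries of the hyperbolic plane; it is oriented if it consists of orientation-preserving isometries, and non-oriented otherwise. An elliptic point of order $2$ of an oriented Fuchsian group is a point of the hyperbolic plane whose stabilizer in the group has order $2$.
   Formalization: Groups with infinitely many elements of order 2 are taken to contain the infinite dihedral group, be virtually torsion-free, or be Fuchsian; non-oriented Fuchsian groups to have an element of order 2 and not be virtually abelian; oriented ones with an order-2 elliptic point to be infinite. *)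

theory Defs
  imports
    "HOL-Analysis.Analysis"
    "HOL-Algebra.Algebra"
    "Jordan_Normal_Form.Matrix"
begin

section \<open>Linear algebraic groups over the complex numbers\<close>

definition GL :: "nat \<Rightarrow> complex mat monoid" where
  "GL n = \<lparr>carrier = {A \<in> carrier_mat n n. invertible_mat A}, mult = (*), one = 1\<^sub>m n\<rparr>"

inductive polynomial_fun :: "nat \<Rightarrow> (complex mat \<Rightarrow> complex) \<Rightarrow> bool" for n :: nat where
  const: "polynomial_fun n (\<lambda>A. c)"
| entry: "i < n \<Longrightarrow> j < n \<Longrightarrow> polynomial_fun n (\<lambda>A. A $$ (i, j))"
| add: "polynomial_fun n p \<Longrightarrow> polynomial_fun n q \<Longrightarrow> polynomial_fun n (\<lambda>A. p A + q A)"
| mult: "polynomial_fun n p \<Longrightarrow> polynomial_fun n q \<Longrightarrow> polynomial_fun n (\<lambda>A. p A * q A)"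

text \<open>The Zariski topology on the complex points of \<open>GL\<^sub>n\<close>, generated by the principal open
  sets. The regular functions on \<open>GL\<^sub>n\<close> are the polynomials in the entries divided by
  powers of the determinant, a unit, so polynomials give the same open sets.\<close>

definition zariski :: "nat \<Rightarrow> complex mat topology" where
  "zariski n = topology_generated_by
     {{A \<in> carrier (GL n). p A \<noteq> 0} | p. polynomial_fun n p}"

text \<open>A linear algebraic group over \<open>\<complex>\<close> is represented by its group of complex points,
  embedded as a Zariski-closed subgroup of some \<open>GL\<^sub>n\<close>.\<close>

definition linear_algebraic_group :: "nat \<Rightarrow> complex mat set \<Rightarrow> bool" where
  "linear_algebraic_group n G \<longleftrightarrow> subgroup G (GL n) \<and> closedin (zariski n) G"

text \<open>Semisimplicity says that the radical is trivial. The radical is the largest connected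
  closed normal solvable subgroup, so it is trivial iff every such subgroup is.\<close>

definition connected_semisimple :: "nat \<Rightarrow> complex mat set \<Rightarrow> bool" where
  "connected_semisimple n G \<longleftrightarrow>
     linear_algebraic_group n G \<and> connectedin (zariski n) G \<and>
     (\<forall>R. R \<lhd> (GL n\<lparr>carrier := G\<rparr>) \<and> closedin (zariski n) R \<and> connectedin (zariski n) R \<and>
          solvable (GL n\<lparr>carrier := R\<rparr>)
        \<longrightarrow> R = {1\<^sub>m n})"

section \<open>Borel's property\<close>

text \<open>\<open>group.ord\<close> is \<open>0\<close> exactly on the elements of infinite order.\<close>

definition Borel_property :: "('a, 'b) monoid_scheme \<Rightarrow> bool" where
  "Borel_property \<Gamma> \<longleftrightarrow>
     (\<forall>n G V. connected_semisimple n G \<and> closedin (zariski n) V \<and> V \<subset> G \<longrightarrow>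
        (\<forall>\<gamma> \<in> carrier \<Gamma>. group.ord \<Gamma> \<gamma> = 0 \<longrightarrow>
           (\<exists>\<phi> \<in> hom \<Gamma> (GL n\<lparr>carrier := G\<rparr>). \<phi> \<gamma> \<notin> V)))"

section \<open>Abstract groups\<close>

text \<open>The infinite dihedral group as the semidirect product of \<open>\<int>\<close> with the group of order
  \<open>2\<close> acting by sign; the Boolean component is true on the reflections.\<close>

definition infinite_dihedral_group :: "(int \<times> bool) monoid" where
  "infinite_dihedral_group =
     \<lparr>carrier = UNIV,
      mult = (\<lambda>(m, s) (n, t). (m + (if s then - n else n), s \<noteq> t)),
      one = (0, False)\<rparr>"

definition involutions :: "('a, 'b) monoid_scheme \<Rightarrow> 'a set" where
  "involutions \<Gamma> = {x \<in> carrier \<Gamma>. group.ord \<Gamma> x = 2}"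

definition virtually_torsion_free :: "('a, 'b) monoid_scheme \<Rightarrow> bool" where
  "virtually_torsion_free \<Gamma> \<longleftrightarrow>
     (\<exists>H. subgroup H \<Gamma> \<and> finite (rcosets\<^bsub>\<Gamma>\<^esub> H) \<and>
          (\<forall>x \<in> H. x \<noteq> \<one>\<^bsub>\<Gamma>\<^esub> \<longrightarrow> group.ord \<Gamma> x = 0))"

definition virtually_abelian :: "('a, 'b) monoid_scheme \<Rightarrow> bool" where
  "virtually_abelian \<Gamma> \<longleftrightarrow>
     (\<exists>H. subgroup H \<Gamma> \<and> finite (rcosets\<^bsub>\<Gamma>\<^esub> H) \<and> comm_group (\<Gamma>\<lparr>carrier := H\<rparr>))"

section \<open>Fuchsian groups\<close>

definition upper_half_plane :: "complex set" where
  "upper_half_plane = {z. Im z > 0}"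

definition hyperbolic_dist :: "complex \<Rightarrow> complex \<Rightarrow> real" where
  "hyperbolic_dist z w = arcosh (1 + (cmod (z - w))\<^sup>2 / (2 * Im z * Im w))"

definition hyperbolic_isometries :: "(complex \<Rightarrow> complex) set" where
  "hyperbolic_isometries =
     {f \<in> Bij upper_half_plane. \<forall>z \<in> upper_half_plane. \<forall>w \<in> upper_half_plane.
        hyperbolic_dist (f z) (f w) = hyperbolic_dist z w}"

text \<open>Discreteness refers to the topology of pointwise convergence, which on the isometry group
  is the usual (compact-open) topology; the hyperbolic metric induces the Euclidean topology on
  the upper half plane.\<close>

definition fuchsian_group :: "(complex \<Rightarrow> complex) set \<Rightarrow> bool" where
  "fuchsian_group \<Gamma> \<longleftrightarrow>
     subgroup \<Gamma> (BijGroup upper_half_plane) \<and> \<Gamma> \<subseteq> hyperbolic_isometries \<and>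
     subtopology
       (product_topology (\<lambda>_. top_of_set upper_half_plane) upper_half_plane) \<Gamma>
       = discrete_topology \<Gamma>"

abbreviation isometry_group :: "(complex \<Rightarrow> complex) set \<Rightarrow> (complex \<Rightarrow> complex) monoid" where
  "isometry_group \<Gamma> \<equiv> BijGroup upper_half_plane\<lparr>carrier := \<Gamma>\<rparr>"

text \<open>The quantity required to be positive is the Jacobian determinant of \<open>f\<close>, regarded as a
  map of the real plane with basis \<open>1, \<i>\<close>.\<close>

definition orientation_preserving :: "(complex \<Rightarrow> complex) \<Rightarrow> bool" where
  "orientation_preserving f \<longleftrightarrow>
     (\<forall>z \<in> upper_half_plane. \<exists>D. (f has_derivative D) (at z) \<and>
        Re (D 1) * Im (D \<i>) - Re (D \<i>) * Im (D 1) > 0)"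

definition oriented :: "(complex \<Rightarrow> complex) set \<Rightarrow> bool" where
  "oriented \<Gamma> \<longleftrightarrow> (\<forall>f \<in> \<Gamma>. orientation_preserving f)"

definition elliptic_point_of_order :: "nat \<Rightarrow> (complex \<Rightarrow> complex) set \<Rightarrow> complex \<Rightarrow> bool" where
  "elliptic_point_of_order m \<Gamma> p \<longleftrightarrow>
     p \<in> upper_half_plane \<and> card (stabilizer (isometry_group \<Gamma>) (\<lambda>g. g) p) = m"

end

theory Submission
  imports Defs
begin

text \<open>
  The only elements of \<open>SL\<^sub>2(\<complex>)\<close> squaring to \<open>1\<close> are \<open>1\<close> and \<open>-1\<close>, so a homomorphism
  to \<open>SL\<^sub>2(\<complex>)\<close> maps a product of two involutions into the proper subvariety \<open>{1, -1}\<close>. Hence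
  two involutions whose product has infinite order refute Borel's property. In a virtually
  torsion-free group, two involutions in the same coset of a torsion-free subgroup of finite
  index serve.

  For a Fuchsian group, isometries are represented by real matrices of determinant \<open>1\<close> or
  \<open>-1\<close>, involutions by traceless ones. Products of involutions with equal determinants have
  infinite order once the absolute value of the trace is at least 2. This always holds for
  distinct half turns, while the reflections whose axes cross two fixed crossing axes form a
  bounded set, which is finite by discreteness. Conversely, if there are only finitely many
  involutions, the centralizer of one of them has finite index. That centralizer is virtually
  abelian, and it fixes the centre of the involution if that is a half turn.
\<close>

section \<open>The special linear group of degree two\<close>

text \<open>For a finitely generated Fuchsian group, Selberg's lemma would supply a torsion-free
  subgroup of finite index, and the coset argument would suffice. Here finite generation is not
  assumed, and elliptic elements of unbounded order may rule out any such subgroup. Infinite order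
  of a product must therefore be detected directly, which is why traces enter. Isometries are given
  as bare distance-preserving bijections, so each one has to be obtained as a matrix, by composing
  with reflections. The matrix is determined only up to a scalar, so determinants are normalised to
  1 or -1 where traces or norms are compared.

  On the algebraic side no structure theory is invoked: SL2 is shown semisimple because a noncentral
  normal subgroup contains all elementary unipotent matrices, and connected because a polynomial
  image of the complex line joins 1 to any given element.\<close>

definition mat2 :: "complex \<Rightarrow> complex \<Rightarrow> complex \<Rightarrow> complex \<Rightarrow> complex mat" where
  "mat2 a b c d = mat 2 2 (\<lambda>(i, j). if i = 0 then if j = 0 then a else b else if j = 0 then c else d)"

definition SL2 :: "complex mat set" where
  "SL2 = {mat2 a b c d | a b c d. a * d - b * c = 1}"

definition scalars_SL2 :: "complex mat set" where
  "scalars_SL2 = {mat2 1 0 0 1, mat2 (- 1) 0 0 (- 1)}"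

abbreviation SL2_group :: "complex mat monoid" where
  "SL2_group \<equiv> GL 2\<lparr>carrier := SL2\<rparr>"

lemma less_2_nat_iff: "i < (2::nat) \<longleftrightarrow> i = 0 \<or> i = 1"
  by auto

lemma mat2_index [simp]:
  "mat2 a b c d $$ (0, 0) = a" "mat2 a b c d $$ (0, Suc 0) = b"
  "mat2 a b c d $$ (Suc 0, 0) = c" "mat2 a b c d $$ (Suc 0, Suc 0) = d"
  by (simp_all add: mat2_def)

lemma mat2_carrier [simp]: "mat2 a b c d \<in> carrier_mat 2 2"
  by (simp add: mat2_def)

lemma mat2_dim [simp]: "dim_row (mat2 a b c d) = 2" "dim_col (mat2 a b c d) = 2"
  by (simp_all add: mat2_def)

lemma mat2_eq_iff [simp]:
  "mat2 a b c d = mat2 a' b' c' d' \<longleftrightarrow> a = a' \<and> b = b' \<and> c = c' \<and> d = d'"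
  by (metis mat2_index)

lemma mat2_cases:
  assumes "A \<in> carrier_mat 2 2"
  obtains a b c d where "A = mat2 a b c d"
proof
  show "A = mat2 (A $$ (0,0)) (A $$ (0,1)) (A $$ (1,0)) (A $$ (1,1))"
    using assms by (intro eq_matI) (auto simp: less_2_nat_iff)
qed

lemma mat2_mult [simp]:
  "mat2 a b c d * mat2 a' b' c' d' =
     mat2 (a * a' + b * c') (a * b' + b * d') (c * a' + d * c') (c * b' + d * d')"
  by (intro eq_matI) (auto simp: less_2_nat_iff scalar_prod_def atLeast0_lessThan_Suc numeral_2_eq_2 less_Suc_eq)

lemma one_mat2: "1\<^sub>m 2 = mat2 1 0 0 1"
  by (intro eq_matI) (auto simp: less_2_nat_iff)

lemma mat2_in_SL2 [simp]: "mat2 a b c d \<in> SL2 \<longleftrightarrow> a * d - b * c = 1"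
  by (auto simp: SL2_def)

lemma GL_mult [simp]: "mult (GL n) = (*)" and GL_one: "one (GL n) = 1\<^sub>m n"
  by (simp_all add: GL_def)

lemma group_GL: "group (GL n)"
proof (rule groupI)
  fix A B assume "A \<in> carrier (GL n)" "B \<in> carrier (GL n)"
  then obtain A' B' where AB: "A \<in> carrier_mat n n" "B \<in> carrier_mat n n"
    "inverts_mat A A'" "inverts_mat A' A" "inverts_mat B B'" "inverts_mat B' B"
    by (auto simp: GL_def invertible_mat_def)
  \<comment> \<open>\<open>inverts_mat\<close> does not mention the format of the inverse; it is
    read off from the sizes of the two identity matrices.\<close>
  then have c: "A' \<in> carrier_mat n n" "B' \<in> carrier_mat n n"
    unfolding inverts_mat_def carrier_mat_def
    by (metis (mono_tags, lifting) carrier_matD(1) index_mult_mat(3) index_one_mat(3) mem_Collect_eq carrier_matD(2))+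
  have inv: "A * A' = 1\<^sub>m n" "A' * A = 1\<^sub>m n" "B * B' = 1\<^sub>m n" "B' * B = 1\<^sub>m n"
    using AB c by (auto simp: inverts_mat_def)
  have "A * B * (B' * A') = A * (B * B') * A'" "B' * A' * (A * B) = B' * (A' * A) * B"
    using AB(1,2) c by (simp_all add: assoc_mult_mat[where n\<^sub>1=n and n\<^sub>2=n and n\<^sub>3=n and n\<^sub>4=n])
  then have "inverts_mat (A * B) (B' * A')" "inverts_mat (B' * A') (A * B)"
    using AB(1,2) c inv by (simp_all add: inverts_mat_def)
  then show "A \<otimes>\<^bsub>GL n\<^esub> B \<in> carrier (GL n)"
    using AB(1,2) by (auto simp: GL_def invertible_mat_def)
next
  fix A assume "A \<in> carrier (GL n)"
  then obtain A' where A: "A \<in> carrier_mat n n" "inverts_mat A A'" "inverts_mat A' A"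
    by (auto simp: GL_def invertible_mat_def)
  then have "A' \<in> carrier_mat n n"
    unfolding inverts_mat_def carrier_mat_def
    by (metis (mono_tags, lifting) carrier_matD(1) index_mult_mat(3) index_one_mat(3) mem_Collect_eq carrier_matD(2))
  then show "\<exists>B\<in>carrier (GL n). B \<otimes>\<^bsub>GL n\<^esub> A = \<one>\<^bsub>GL n\<^esub>"
    using A by (intro bexI[of _ A']) (auto simp: GL_def invertible_mat_def inverts_mat_def)
qed (auto simp: GL_def invertible_mat_def inverts_mat_def
      assoc_mult_mat[where n\<^sub>1=n and n\<^sub>2=n and n\<^sub>3=n and n\<^sub>4=n] intro!: exI[of _ "1\<^sub>m n"])

interpretation GL: group "GL n" for n
  by (rule group_GL)

lemma SL2_in_GL: "SL2 \<subseteq> carrier (GL 2)"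
proof
  fix A assume "A \<in> SL2"
  then obtain a b c d where A: "A = mat2 a b c d" "a * d - b * c = 1"
    by (auto simp: SL2_def)
  then have "inverts_mat A (mat2 d (- b) (- c) a)" "inverts_mat (mat2 d (- b) (- c) a) A"
    by (auto simp: inverts_mat_def one_mat2 algebra_simps)
  then show "A \<in> carrier (GL 2)"
    using A(1) by (auto simp: GL_def invertible_mat_def)
qed

lemma inv_SL2:
  assumes "a * d - b * c = 1"
  shows "inv\<^bsub>GL 2\<^esub> (mat2 a b c d) = mat2 d (- b) (- c) a"
proof (rule GL.inv_equality)
  show "mat2 d (- b) (- c) a \<otimes>\<^bsub>GL 2\<^esub> mat2 a b c d = \<one>\<^bsub>GL 2\<^esub>"
    using assms by (simp add: GL_one one_mat2 algebra_simps)
qed (use assms SL2_in_GL in \<open>auto simp: algebra_simps\<close>)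

lemma subgroup_SL2: "subgroup SL2 (GL 2)"
proof (rule GL.subgroupI)
  fix A B assume "A \<in> SL2" "B \<in> SL2"
  then obtain a b c d a' b' c' d' where *: "A = mat2 a b c d" "a * d - b * c = 1"
    "B = mat2 a' b' c' d'" "a' * d' - b' * c' = 1"
    by (auto simp: SL2_def)
  have "(a * a' + b * c') * (c * b' + d * d') - (a * b' + b * d') * (c * a' + d * c')
      = (a * d - b * c) * (a' * d' - b' * c')"
    by (simp add: algebra_simps)
  then show "A \<otimes>\<^bsub>GL 2\<^esub> B \<in> SL2"
    using * by simp
next
  fix A assume "A \<in> SL2"
  then show "inv\<^bsub>GL 2\<^esub> A \<in> SL2"
    by (auto simp: SL2_def inv_SL2) (metis mult.commute minus_mult_minus)
next
  have "mat2 1 0 0 1 \<in> SL2" by simp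
  then show "SL2 \<noteq> {}" by blast
qed (rule SL2_in_GL)

interpretation SL2: group SL2_group
  by (rule GL.subgroup_imp_group[OF subgroup_SL2])

lemma inv_SL2_group:
  assumes "a * d - b * c = 1"
  shows "inv\<^bsub>SL2_group\<^esub> (mat2 a b c d) = mat2 d (- b) (- c) a"
  using GL.m_inv_consistent[OF subgroup_SL2] inv_SL2 assms by simp

subsection \<open>Normal subgroups\<close>

lemma normal_SL2_conj:
  assumes "N \<lhd> SL2_group" "mat2 a b c d \<in> N" "x * w - y * z = 1"
  shows "mat2 x y z w * mat2 a b c d * mat2 w (- y) (- z) x \<in> N"
  using normal.inv_op_closed2[OF assms(1), of "mat2 x y z w" "mat2 a b c d"] assms
  by (simp add: inv_SL2_group)

lemma normal_SL2_commutator: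
  assumes "N \<lhd> SL2_group" "mat2 a b c d \<in> N" "x * w - y * z = 1"
  shows "mat2 x y z w * mat2 a b c d * mat2 w (- y) (- z) x * mat2 d (- b) (- c) a \<in> N"
proof -
  interpret N: normal N SL2_group by fact
  have "a * d - b * c = 1"
    using N.subset assms(2) by auto
  moreover have "inv\<^bsub>SL2_group\<^esub> (mat2 a b c d) \<in> N"
    using assms(2) by blast
  ultimately have "mat2 d (- b) (- c) a \<in> N"
    by (simp add: inv_SL2_group)
  from N.m_closed[OF normal_SL2_conj[OF assms] this] show ?thesis
    by simp
qed

text \<open>The expression is det (v, A v) for v = (x, z), a quadratic form in v. Its values at
  three vectors show that it vanishes identically only for scalar A, and a nonzero value becomes 1
  after dividing v by its square root.\<close>

lemma noncentral_SL2_cyclic_vector: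
  assumes "a * d - b * c = (1::complex)" "mat2 a b c d \<notin> scalars_SL2"
  obtains x z where "x * (c * x + d * z) - z * (a * x + b * z) = 1"
proof -
  let ?q = "\<lambda>x z. x * (c * x + d * z) - z * (a * x + b * z)"
  have "?q 1 0 \<noteq> 0 \<or> ?q 0 1 \<noteq> 0 \<or> ?q 1 1 \<noteq> 0"
  proof (rule ccontr)
    assume "\<not> ?thesis"
    then have "b = 0" "c = 0" "a = d" by auto
    with assms show False
      by (auto simp: scalars_SL2_def power2_eq_square[symmetric] power2_eq_1_iff)
  qed
  then obtain x z where q: "?q x z \<noteq> 0" by blast
  let ?r = "csqrt (?q x z)"
  have "?q (x / ?r) (z / ?r) = ?q x z / ?r\<^sup>2"
    by (simp add: power2_eq_square diff_divide_distrib add_divide_distrib algebra_simps)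
  with q show thesis
    by (intro that[of "x / ?r" "z / ?r"]) simp
qed

text \<open>Conjugating to the companion matrix \<open>(0 -1; 1 t)\<close>, the commutator with
  \<open>diag(r, 1/r)\<close>, \<open>r\<^sup>2 = 2\<close>, is lower triangular with eigenvalues 2 and 1/2, and the
  commutators of such a matrix with lower unitriangular matrices exhaust the latter.\<close>

lemma noncentral_normal_SL2:
  assumes "N \<lhd> SL2_group" "\<not> N \<subseteq> scalars_SL2"
  shows "mat2 1 0 s 1 \<in> N" "mat2 1 s 0 1 \<in> N"
proof -
  interpret N: normal N SL2_group by fact
  obtain B where B: "B \<in> N" "B \<notin> scalars_SL2" "B \<in> SL2"
    using assms(2) N.subset by auto
  then obtain a b c d where A: "mat2 a b c d \<in> N" "mat2 a b c d \<notin> scalars_SL2"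
    by (auto simp: SL2_def)
  then have det: "a * d - b * c = 1"
    using N.subset by auto
  obtain x z where xz: "x * (c * x + d * z) - z * (a * x + b * z) = 1"
    using noncentral_SL2_cyclic_vector[OF det A(2)] by blast
  \<comment> \<open>(y, w) is the image of the cyclic vector (x, z), so the matrix with these two
    columns conjugates the given one into companion form.\<close>
  define y w where "y = a * x + b * z" and "w = c * x + d * z"
  have P: "x * w - y * z = 1"
    using xz by (simp add: y_def w_def algebra_simps)
  have P': "w * x - (- y) * (- z) = 1"
    using P by (simp add: algebra_simps)
  define t where "t = a + d"
  have e1: "(w * a + - y * c) * x + (w * b + - y * d) * z = 0"
    unfolding y_def w_def by (simp add: algebra_simps)
  have e2: "(- z * a + x * c) * x + (- z * b + x * d) * z = 1"
    using P unfolding y_def w_def by (simp add: algebra_simps)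
  have e3: "(w * a + - y * c) * y + (w * b + - y * d) * w = - 1"
  proof -
    have "(w * a + - y * c) * y + (w * b + - y * d) * w = - ((a * d - b * c) * (x * w - y * z))"
      by (simp add: y_def w_def algebra_simps)
    then show ?thesis by (simp add: P det)
  qed
  have e4: "(- z * a + x * c) * y + (- z * b + x * d) * w = t"
  proof -
    have "(- z * a + x * c) * y + (- z * b + x * d) * w = (a + d) * (x * w - y * z)"
      by (simp add: y_def w_def algebra_simps)
    then show ?thesis by (simp add: P t_def)
  qed
  have comp: "mat2 0 (- 1) 1 t \<in> N"
    using normal_SL2_conj[OF assms(1) A(1) P'] e1 e2 e3 e4 by simp
  define r where "r = csqrt 2"
  have r: "r * r = 2" "r \<noteq> 0"
    using power2_csqrt[of 2] by (auto simp: r_def power2_eq_square simp del: csqrt_of_real_nonneg)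
  have r': "1 / r * (1 / r) = 1 / 2"
    using r by (simp add: field_simps)
  have "\<exists>u. mat2 2 0 u (1/2) \<in> N"
    using normal_SL2_commutator[OF assms(1) comp, of r "1 / r" 0 0] r r' by auto
  then obtain u where u: "mat2 2 0 u (1/2) \<in> N" by blast
  have lower: "mat2 1 0 s 1 \<in> N" for s
  proof -
    \<comment> \<open>The commutator of the lower unitriangular matrix with entry q and
      \<open>mat2 2 0 u (1/2)\<close> has entry (1 - 1/4) q, whatever u is; hence the factor
      4/3.\<close>
    have *: "s * (4/3) * 2 * (1/2) + u * (1/2) + (- (s * (4/3)) * (1/2) * (1/2) - u * (1/2)) = s"
      by (simp add: algebra_simps)
    show ?thesis
      using normal_SL2_commutator[OF assms(1) u, of 1 1 0 "s * (4/3)"] *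
      by (simp add: algebra_simps)
  qed
  then show "mat2 1 0 s 1 \<in> N" .
  \<comment> \<open>Conjugation by the Weyl element (0 1; -1 0) exchanges lower and upper
    unitriangular matrices, up to the sign of the entry.\<close>
  show "mat2 1 s 0 1 \<in> N"
    using normal_SL2_conj[OF assms(1) lower[of "- s"], of 0 0 1 "- 1"] by simp
qed

text \<open>Two elementary unipotent matrices in N already have a noncentral commutator. So the
  derived series of a noncentral normal subgroup never becomes central, let alone trivial.\<close>

lemma derived_noncentral_normal_SL2:
  assumes "N \<lhd> SL2_group" "\<not> N \<subseteq> scalars_SL2"
  shows "\<not> derived SL2_group N \<subseteq> scalars_SL2"
proof -
  let ?E = "mat2 1 1 0 1" and ?F = "mat2 1 0 1 1"
  have "?E \<otimes>\<^bsub>SL2_group\<^esub> ?F \<otimes>\<^bsub>SL2_group\<^esub> inv\<^bsub>SL2_group\<^esub> ?E \<otimes>\<^bsub>SL2_group\<^esub> inv\<^bsub>SL2_group\<^esub> ?F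
      \<in> derived SL2_group N"
    unfolding derived_def
    by (rule generate.incl) (use noncentral_normal_SL2[OF assms] in blast)
  then have "mat2 3 (- 1) 1 0 \<in> derived SL2_group N"
    by (simp add: inv_SL2_group)
  then show ?thesis
    by (auto simp: scalars_SL2_def)
qed

lemma solvable_normal_SL2:
  assumes "R \<lhd> SL2_group" "solvable (GL 2\<lparr>carrier := R\<rparr>)"
  shows "R \<subseteq> scalars_SL2"
proof (rule ccontr)
  assume nc: "\<not> R \<subseteq> scalars_SL2"
  interpret R: normal R SL2_group by fact
  let ?R = "GL 2\<lparr>carrier := R\<rparr>"
  have R: "group ?R"
    using R.subgroup_is_group[OF SL2.is_group] by simp
  have step: "(derived SL2_group ^^ k) R \<lhd> SL2_group \<and> \<not> (derived SL2_group ^^ k) R \<subseteq> scalars_SL2" for k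
    by (induction k) (use nc assms SL2.derived_is_normal derived_noncentral_normal_SL2 in auto)
  \<comment> \<open>Solvability speaks of \<open>?R\<close> as a group of its own; its derived
    series is identified with the one formed in SL2, where normality can be used.\<close>
  have "(derived ?R ^^ k) R = (derived SL2_group ^^ k) R \<and> (derived ?R ^^ k) R \<subseteq> R" for k
  proof (induction k)
    case (Suc k)
    then have "(derived SL2_group ^^ k) R \<subseteq> R" by metis
    from SL2.derived_consistent[OF this R.subgroup_axioms]
      SL2.derived_incl[OF this R.subgroup_axioms] Suc show ?case
      by simp
  qed auto
  moreover obtain k where "(derived ?R ^^ k) R = {\<one>\<^bsub>?R\<^esub>}"
    using group.solvable_iff_trivial_derived_seq[OF R] assms(2) by auto
  ultimately have "(derived SL2_group ^^ k) R = {1\<^sub>m 2}"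
    by (simp add: GL_one)
  then show False
    using step[of k] by (auto simp: scalars_SL2_def one_mat2)
qed

subsection \<open>The Zariski topology\<close>

lemma topspace_zariski [simp]: "topspace (zariski n) = carrier (GL n)"
proof -
  have "polynomial_fun n (\<lambda>A. 1)"
    by (rule polynomial_fun.const)
  then show ?thesis
    unfolding zariski_def topology_generated_by_topspace by fastforce
qed

lemma openin_zariski:
  assumes "polynomial_fun n p"
  shows "openin (zariski n) {A \<in> carrier (GL n). p A \<noteq> 0}"
  unfolding zariski_def using assms by (intro topology_generated_by_Basis) blast

lemma closedin_zariski:
  assumes "polynomial_fun n p"
  shows "closedin (zariski n) {A \<in> carrier (GL n). p A = 0}"
proof -
  have "topspace (zariski n) - {A \<in> carrier (GL n). p A = 0} = {A \<in> carrier (GL n). p A \<noteq> 0}"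
    by auto
  then show ?thesis
    using openin_zariski[OF assms] unfolding closedin_def by auto
qed

lemma polynomial_fun_2_intros:
  "polynomial_fun 2 (\<lambda>A. A $$ (0, 0))" "polynomial_fun 2 (\<lambda>A. A $$ (0, Suc 0))"
  "polynomial_fun 2 (\<lambda>A. A $$ (Suc 0, 0))" "polynomial_fun 2 (\<lambda>A. A $$ (Suc 0, Suc 0))"
  by (auto intro!: polynomial_fun.entry)

lemma closedin_SL2: "closedin (zariski 2) SL2"
proof -
  let ?p = "\<lambda>A. (A $$ (0, 0) * A $$ (Suc 0, Suc 0) + (- 1) * (A $$ (0, Suc 0) * A $$ (Suc 0, 0))) + (- 1)"
  have "polynomial_fun 2 ?p"
    by (intro polynomial_fun.intros polynomial_fun_2_intros)
  then have "closedin (zariski 2) {A \<in> carrier (GL 2). ?p A = 0}"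
    by (rule closedin_zariski)
  moreover have "{A \<in> carrier (GL 2). ?p A = 0} = SL2"
  proof (intro equalityI subsetI)
    fix A assume A: "A \<in> {A \<in> carrier (GL 2). ?p A = 0}"
    then have "A \<in> carrier_mat 2 2" by (simp add: GL_def)
    with A show "A \<in> SL2" by (elim mat2_cases) simp
  qed (use SL2_in_GL in \<open>auto simp: SL2_def\<close>)
  ultimately show ?thesis by simp
qed

lemma closedin_scalars_SL2: "closedin (zariski 2) scalars_SL2"
proof -
  let ?Z = "\<lambda>p. {A \<in> carrier (GL 2). p A = (0 :: complex)}"
  have "closedin (zariski 2) (?Z (\<lambda>A. A $$ (0, Suc 0)))" "closedin (zariski 2) (?Z (\<lambda>A. A $$ (Suc 0, 0)))"
    "closedin (zariski 2) (?Z (\<lambda>A. A $$ (0, 0) + (- 1) * A $$ (Suc 0, Suc 0)))"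
    by (intro closedin_zariski polynomial_fun.intros polynomial_fun_2_intros)+
  then have "closedin (zariski 2) (SL2 \<inter> ?Z (\<lambda>A. A $$ (0, Suc 0)) \<inter> ?Z (\<lambda>A. A $$ (Suc 0, 0)) \<inter>
      ?Z (\<lambda>A. A $$ (0, 0) + (- 1) * A $$ (Suc 0, Suc 0)))" (is "closedin _ ?S")
    by (intro closedin_Int closedin_SL2)
  moreover have "?S = scalars_SL2"
  proof (intro equalityI subsetI)
    fix A assume A: "A \<in> ?S"
    then obtain a b c d where abcd: "A = mat2 a b c d" by (auto simp: SL2_def)
    with A have "b = 0" "c = 0" "a = d" "a * d = 1" by auto
    then show "A \<in> scalars_SL2"
      using abcd by (auto simp: scalars_SL2_def power2_eq_square[symmetric] power2_eq_1_iff)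
  next
    fix A assume "A \<in> scalars_SL2"
    then show "A \<in> ?S"
      using subsetD[OF SL2_in_GL, of A] by (auto simp: scalars_SL2_def)
  qed
  ultimately show ?thesis by simp
qed

text \<open>Polynomials in continuous entries are continuous, so principal open sets pull back to
  Euclidean open sets. This turns Euclidean connectedness of the complex line into Zariski
  connectedness of its image.\<close>

lemma continuous_map_zariski:
  assumes "\<And>t. c t \<in> carrier (GL n)"
    and "\<And>i j. i < n \<Longrightarrow> j < n \<Longrightarrow> continuous_on UNIV (\<lambda>t. c t $$ (i, j))"
  shows "continuous_map (euclidean :: complex topology) (zariski n) c"
  unfolding zariski_def
proof (rule continuous_on_generated_topo, goal_cases)
  case (1 U)
  then obtain p where p: "polynomial_fun n p" "U = {A \<in> carrier (GL n). p A \<noteq> 0}" by blast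
  from p(1) have "continuous_on UNIV (\<lambda>t. p (c t))"
    by induction (auto intro!: continuous_intros assms)
  moreover have "c -` U = - ((\<lambda>t. p (c t)) -` {0})"
    using assms(1) p(2) by auto
  ultimately show ?case
    using continuous_on_open_vimage[of UNIV "\<lambda>t. p (c t)"]
    by (metis Int_UNIV_right open_Compl closed_singleton open_UNIV open_openin topspace_euclidean vimage_Compl)
next
  case 2
  then show ?case
    using assms(1) polynomial_fun.const[of n 1] by fastforce
qed

section \<open>Connectedness and semisimplicity of SL2\<close>

definition unipotent_product :: "complex \<Rightarrow> complex \<Rightarrow> complex \<Rightarrow> complex \<Rightarrow> complex mat" where
  "unipotent_product x y z w = mat2 1 x 0 1 * mat2 1 0 y 1 * mat2 1 z 0 1 * mat2 1 0 w 1"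

lemma unipotent_product_in_SL2 [simp]: "unipotent_product x y z w \<in> SL2"
  by (simp add: unipotent_product_def algebra_simps)

lemma SL2_unipotent_product:
  assumes "A \<in> SL2"
  obtains x y z w where "A = unipotent_product x y z w"
proof -
  obtain a b c d where A: "A = mat2 a b c d" "a * d - b * c = 1"
    using assms by (auto simp: SL2_def)
  show thesis
  proof (cases "c = 0")
    case True
    with A have "d \<noteq> 0" "a * d = 1" by auto
    \<comment> \<open>Multiplying by \<open>mat2 1 0 1 1\<close> on the right moves d into the lower
      left corner, which reduces to the other case; the last parameter -1 undoes this.\<close>
    with True A(1) show thesis
      by (intro that[of "(a + b - 1) / d" d "(d - 1) / d" "- 1"])
        (simp add: unipotent_product_def field_simps)
  next
    case False
    \<comment> \<open>Three factors suffice: the middle one carries c, and the outer ones adjust the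
      diagonal entries to a and d, after which the determinant fixes b.\<close>
    with A show thesis
      by (intro that[of "(a - 1) / c" c "(d - 1) / c" 0])
        (simp add: unipotent_product_def field_simps)
  qed
qed

text \<open>Scaling all four unipotent parameters by t gives a connected image of the complex line
  containing 1 (t = 0) and a given element (t = 1). SL2 is the union of these images, which share
  the point 1.\<close>

lemma connectedin_SL2: "connectedin (zariski 2) SL2"
proof -
  let ?c = "\<lambda>x y z w t. unipotent_product (t * x) (t * y) (t * z) (t * w)"
  have con: "connectedin (zariski 2) (range (?c x y z w))" for x y z w
  proof (rule connectedin_continuous_map_image)
    show "continuous_map (euclidean :: complex topology) (zariski 2) (?c x y z w)"
    proof (rule continuous_map_zariski)
      show "?c x y z w t \<in> carrier (GL 2)" for t
        using SL2_in_GL by auto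
      fix i j :: nat assume "i < 2" "j < 2"
      then show "continuous_on UNIV (\<lambda>t. ?c x y z w t $$ (i, j))"
        by (auto simp: less_2_nat_iff unipotent_product_def intro!: continuous_intros)
    qed
  qed (simp add: connectedin_iff_connected connected_UNIV)
  have one: "1\<^sub>m 2 \<in> range (?c x y z w)" for x y z w
    by (rule range_eqI[of _ _ 0]) (simp add: one_mat2 unipotent_product_def)
  have "connectedin (zariski 2) (\<Union>{range (?c x y z w) | x y z w. True})"
  proof (intro connectedin_Union)
    show "\<Inter>{range (?c x y z w) | x y z w. True} \<noteq> {}"
      using one by blast
  qed (use con in auto)
  moreover have "\<Union>{range (?c x y z w) | x y z w. True} = SL2"
  proof (intro equalityI subsetI)
    fix A assume "A \<in> SL2"
    then obtain x y z w where "A = ?c x y z w 1"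
      by (metis SL2_unipotent_product mult_1)
    then show "A \<in> \<Union>{range (?c x y z w) | x y z w. True}"
      by blast
  qed auto
  ultimately show ?thesis by simp
qed

text \<open>The top left entry separates 1 from -1: each of the principal open sets where it differs
  from 1 or from -1 contains exactly one of the two scalars.\<close>

lemma connectedin_scalars_SL2_trivial:
  assumes "connectedin (zariski 2) R" "R \<subseteq> scalars_SL2" "1\<^sub>m 2 \<in> R"
  shows "R = {1\<^sub>m 2}"
proof -
  let ?U = "\<lambda>e. {A \<in> carrier (GL 2). A $$ (0, 0) + e \<noteq> (0 :: complex)}"
  have op: "openin (zariski 2) (?U e)" for e
    by (intro openin_zariski polynomial_fun.intros polynomial_fun_2_intros)
  have "mat2 (- 1) 0 0 (- 1) \<notin> R"
  proof
    assume "mat2 (- 1) 0 0 (- 1) \<in> R"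
    then have "R \<inter> ?U (- 1) \<noteq> {}" "R \<inter> ?U 1 \<noteq> {}"
      using assms(3) connectedin_subset_topspace[OF assms(1)] by (auto simp: one_mat2 intro!: exI[of _ "mat2 1 0 0 1"])
    moreover have "R \<subseteq> ?U (- 1) \<union> ?U 1" "R \<inter> ?U (- 1) \<inter> ?U 1 = {}"
      using assms(2) connectedin_subset_topspace[OF assms(1)] by (auto simp: scalars_SL2_def)
    moreover have "?U (- 1) \<inter> ?U 1 \<inter> R = {}"
      using calculation by blast
    ultimately show False
      using assms(1) op[of 1] op[of "- 1"] unfolding connectedin
      by (metis (no_types, lifting) Int_commute)
  qed
  with assms(2,3) show ?thesis
    by (auto simp: scalars_SL2_def one_mat2)
qed

lemma connected_semisimple_SL2: "connected_semisimple 2 SL2"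
  unfolding connected_semisimple_def linear_algebraic_group_def
proof (intro conjI allI impI)
  fix R assume R: "R \<lhd> SL2_group \<and> closedin (zariski 2) R \<and> connectedin (zariski 2) R \<and>
    solvable (GL 2\<lparr>carrier := R\<rparr>)"
  then have "\<one>\<^bsub>SL2_group\<^esub> \<in> R"
    by (meson normal_imp_subgroup subgroup.one_closed)
  then show "R = {1\<^sub>m 2}"
    using R connectedin_scalars_SL2_trivial solvable_normal_SL2 by (simp add: GL_one)
qed (rule subgroup_SL2 closedin_SL2 connectedin_SL2)+

section \<open>Failure of Borel's property\<close>

text \<open>The only involution of \<open>SL\<^sub>2\<close> is \<open>-1\<close>, so a product of two involutions always
  lands in \<open>{1, -1}\<close>.\<close>

lemma SL2_square_one:
  assumes "A \<in> SL2" "A * A = 1\<^sub>m 2"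
  shows "A \<in> scalars_SL2"
proof -
  obtain a b c d where A: "A = mat2 a b c d" "a * d - b * c = 1"
    using assms by (auto simp: SL2_def)
  with assms(2) have e: "a * a + b * c = 1" "a * b + b * d = 0" "c * a + d * c = 0" "c * b + d * d = 1"
    by (auto simp: one_mat2)
  have "a + d \<noteq> 0"
  proof
    assume "a + d = 0"
    then have "d = - a" by (simp add: add_eq_0_iff2)
    with A(2) have "- (a * a + b * c) = 1" by (simp add: algebra_simps)
    with e(1) show False by simp
  qed
  moreover have "(a + d) * b = 0" "(a + d) * c = 0" "a * a - d * d = 0"
    using e(2,3) arg_cong2[OF e(1) e(4), of "(-)"] by (simp_all add: algebra_simps)
  moreover from this(3) have "(a + d) * (a - d) = 0" by (simp add: algebra_simps)
  ultimately have "b = 0" "c = 0" "a = d" by auto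
  moreover from this have "a\<^sup>2 = 1"
    using e(1) by (simp add: power2_eq_square)
  ultimately show ?thesis
    using A(1) by (auto simp: scalars_SL2_def power2_eq_1_iff)
qed

lemma not_Borel_property_if_involutions:
  assumes "group \<Gamma>" "s \<in> carrier \<Gamma>" "t \<in> carrier \<Gamma>"
    and "s \<otimes>\<^bsub>\<Gamma>\<^esub> s = \<one>\<^bsub>\<Gamma>\<^esub>" "t \<otimes>\<^bsub>\<Gamma>\<^esub> t = \<one>\<^bsub>\<Gamma>\<^esub>"
    and "\<And>n. n \<noteq> 0 \<Longrightarrow> (s \<otimes>\<^bsub>\<Gamma>\<^esub> t) [^]\<^bsub>\<Gamma>\<^esub> (n::nat) \<noteq> \<one>\<^bsub>\<Gamma>\<^esub>"
  shows "\<not> Borel_property \<Gamma>"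
proof
  assume Borel: "Borel_property \<Gamma>"
  interpret \<Gamma>: group \<Gamma> by fact
  have "mat2 2 0 0 (1/2) \<in> SL2 - scalars_SL2"
    by (simp add: scalars_SL2_def)
  moreover have "scalars_SL2 \<subseteq> SL2"
    by (simp add: scalars_SL2_def)
  ultimately have "scalars_SL2 \<subset> SL2"
    by blast
  moreover have "\<Gamma>.ord (s \<otimes>\<^bsub>\<Gamma>\<^esub> t) = 0"
    using assms by (subst \<Gamma>.ord_eq_0) auto
  ultimately obtain \<phi> where \<phi>: "\<phi> \<in> hom \<Gamma> SL2_group" "\<phi> (s \<otimes>\<^bsub>\<Gamma>\<^esub> t) \<notin> scalars_SL2"
    using Borel connected_semisimple_SL2 closedin_scalars_SL2 assms(2,3)
    unfolding Borel_property_def by (meson \<Gamma>.m_closed)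
  interpret \<phi>: group_hom \<Gamma> SL2_group \<phi>
    using \<phi>(1) by unfold_locales
  have "\<phi> u \<in> scalars_SL2" if "u \<in> carrier \<Gamma>" "u \<otimes>\<^bsub>\<Gamma>\<^esub> u = \<one>\<^bsub>\<Gamma>\<^esub>" for u
  proof (rule SL2_square_one)
    show "\<phi> u \<in> SL2" using \<phi>.hom_closed[OF that(1)] by simp
    show "\<phi> u * \<phi> u = 1\<^sub>m 2"
      using \<phi>.hom_mult[OF that(1) that(1)] that(2) by (simp add: GL_one)
  qed
  from this[of s] this[of t] have "\<phi> s * \<phi> t \<in> scalars_SL2"
    using assms by (auto simp: scalars_SL2_def)
  with \<phi>(2) show False
    using assms(2,3) by simp
qed

section \<open>The infinite dihedral group\<close>

lemma group_infinite_dihedral_group: "group infinite_dihedral_group"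
proof (rule groupI)
  fix x :: "int \<times> bool"
  show "\<exists>y\<in>carrier infinite_dihedral_group. y \<otimes>\<^bsub>infinite_dihedral_group\<^esub> x = \<one>\<^bsub>infinite_dihedral_group\<^esub>"
    by (rule bexI[of _ "(if snd x then fst x else - fst x, snd x)"])
      (auto simp: infinite_dihedral_group_def split: prod.splits)
qed (auto simp: infinite_dihedral_group_def)

lemma translation_power:
  "(- 1, False) [^]\<^bsub>infinite_dihedral_group\<^esub> (n::nat) = (- int n, False)"
  by (induction n) (simp_all add: nat_pow_def infinite_dihedral_group_def)

text \<open>The reflections \<open>(0, True)\<close> and \<open>(1, True)\<close> have as product
  the translation by -1, of infinite order. Their images obstruct inside the whole group, since
  every homomorphism from it restricts to the subgroup; none has to be extended.\<close>

lemma not_Borel_property_if_dihedral_subgroup: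
  assumes "group \<Gamma>" "subgroup H \<Gamma>" "infinite_dihedral_group \<cong> \<Gamma>\<lparr>carrier := H\<rparr>"
  shows "\<not> Borel_property \<Gamma>"
proof -
  let ?D = infinite_dihedral_group and ?H = "\<Gamma>\<lparr>carrier := H\<rparr>"
  interpret \<Gamma>: group \<Gamma> by fact
  interpret H: group ?H using assms(2) by (rule \<Gamma>.subgroup_imp_group)
  obtain h where h: "h \<in> iso ?D ?H"
    using assms(3) by (auto simp: is_iso_def)
  interpret h: group_hom ?D ?H h
    using h group_infinite_dihedral_group H.is_group
    by (simp add: group_hom_def group_hom_axioms_def iso_def)
  have D: "carrier ?D = UNIV" "\<one>\<^bsub>?D\<^esub> = (0, False)"
    "(0, True) \<otimes>\<^bsub>?D\<^esub> (0, True) = (0, False)" "(1, True) \<otimes>\<^bsub>?D\<^esub> (1, True) = (0, False)"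
    "(0, True) \<otimes>\<^bsub>?D\<^esub> (1, True) = (- 1, False)"
    by (auto simp: infinite_dihedral_group_def)
  have h_mult: "h x \<otimes>\<^bsub>\<Gamma>\<^esub> h y = h (x \<otimes>\<^bsub>?D\<^esub> y)" for x y
    using h.hom_mult[of x y] D by simp
  have h_H: "h x \<in> H" for x
    using h.hom_closed[of x] D by simp
  have h_one: "h (0, False) = \<one>\<^bsub>\<Gamma>\<^esub>"
    using h.hom_one D by simp
  have inj: "h x = h y \<Longrightarrow> x = y" for x y
    using h D(1) by (auto simp: iso_def bij_betw_def dest: injD)
  show ?thesis
  proof (rule not_Borel_property_if_involutions[OF assms(1), of "h (0, True)" "h (1, True)"])
    fix n :: nat assume "n \<noteq> 0"
    have "h (- 1, False) [^]\<^bsub>\<Gamma>\<^esub> n = h (- int n, False)"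
      using h.hom_nat_pow[of "(- 1, False)" n] D translation_power \<Gamma>.nat_pow_consistent by simp
    with \<open>n \<noteq> 0\<close> show "(h (0, True) \<otimes>\<^bsub>\<Gamma>\<^esub> h (1, True)) [^]\<^bsub>\<Gamma>\<^esub> n \<noteq> \<one>\<^bsub>\<Gamma>\<^esub>"
      unfolding h_mult D h_one[symmetric] by (auto dest: inj)
  qed (use h_H subgroup.subset[OF assms(2)] in \<open>auto simp: h_mult D h_one\<close>)
qed

lemma not_Borel_property_infinite_dihedral_group: "\<not> Borel_property infinite_dihedral_group"
proof (rule not_Borel_property_if_dihedral_subgroup)
  show "subgroup (carrier infinite_dihedral_group) infinite_dihedral_group"
    using group.subgroup_self[OF group_infinite_dihedral_group] .
  show "infinite_dihedral_group \<cong> infinite_dihedral_group\<lparr>carrier := carrier infinite_dihedral_group\<rparr>"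
    by (simp add: iso_refl)
qed (rule group_infinite_dihedral_group)

section \<open>Virtually torsion-free groups with infinitely many involutions\<close>

lemma (in group) involutions_iff: "x \<in> involutions G \<longleftrightarrow> x \<in> carrier G \<and> x \<noteq> \<one> \<and> x \<otimes> x = \<one>"
proof (cases "x \<in> carrier G")
  case True
  have "ord x dvd 2 \<longleftrightarrow> ord x = 1 \<or> ord x = 2"
    using prime_nat_iff two_is_prime_nat by auto
  moreover have "x \<otimes> x = \<one> \<longleftrightarrow> ord x dvd 2"
    using pow_eq_id[OF True, of 2] True by (simp add: numeral_2_eq_2)
  ultimately show ?thesis
    using ord_eq_1[OF True] True by (auto simp: involutions_def)
qed (simp add: involutions_def)

lemma not_Borel_property_if_infinitely_many_involutions:
  assumes "group \<Gamma>" "virtually_torsion_free \<Gamma>" "infinite (involutions \<Gamma>)"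
  shows "\<not> Borel_property \<Gamma>"
proof -
  interpret \<Gamma>: group \<Gamma> by fact
  obtain H where H: "subgroup H \<Gamma>" "finite (rcosets\<^bsub>\<Gamma>\<^esub> H)"
    "\<And>x. x \<in> H \<Longrightarrow> x \<noteq> \<one>\<^bsub>\<Gamma>\<^esub> \<Longrightarrow> \<Gamma>.ord x = 0"
    using assms(2) by (auto simp: virtually_torsion_free_def)
  have "(\<lambda>s. H #>\<^bsub>\<Gamma>\<^esub> s) ` involutions \<Gamma> \<subseteq> rcosets\<^bsub>\<Gamma>\<^esub> H"
    by (auto simp: RCOSETS_def involutions_def)
  then have "\<not> inj_on (\<lambda>s. H #>\<^bsub>\<Gamma>\<^esub> s) (involutions \<Gamma>)"
    using assms(3) H(2) inj_on_finite by blast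
  then obtain s t where st: "s \<in> involutions \<Gamma>" "t \<in> involutions \<Gamma>" "s \<noteq> t"
    "H #>\<^bsub>\<Gamma>\<^esub> s = H #>\<^bsub>\<Gamma>\<^esub> t"
    by (auto simp: inj_on_def)
  then have s: "s \<in> carrier \<Gamma>" "s \<otimes>\<^bsub>\<Gamma>\<^esub> s = \<one>\<^bsub>\<Gamma>\<^esub>" and t: "t \<in> carrier \<Gamma>" "t \<otimes>\<^bsub>\<Gamma>\<^esub> t = \<one>\<^bsub>\<Gamma>\<^esub>"
    by (auto simp: \<Gamma>.involutions_iff)
  have "s \<in> H #>\<^bsub>\<Gamma>\<^esub> t"
    using \<Gamma>.rcos_self[OF s(1) H(1)] st(4) by simp
  \<comment> \<open>If s = h t with h in H, then s t = h, as t is its own inverse.\<close>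
  then have "s \<otimes>\<^bsub>\<Gamma>\<^esub> t \<in> H"
    using subgroup.subset[OF H(1)] t by (auto simp: r_coset_def \<Gamma>.m_assoc)
  moreover have "s \<otimes>\<^bsub>\<Gamma>\<^esub> t \<noteq> \<one>\<^bsub>\<Gamma>\<^esub>"
    using st(3) s t by (metis \<Gamma>.r_cancel)
  ultimately have "\<Gamma>.ord (s \<otimes>\<^bsub>\<Gamma>\<^esub> t) = 0"
    by (rule H(3))
  then show ?thesis
    using s t by (intro not_Borel_property_if_involutions[OF assms(1), of s t]) (simp_all add: \<Gamma>.ord_eq_0)
qed

section \<open>Isometries of the upper half plane\<close>

subsection \<open>Real matrices of size two\<close>

no_notation vec_index (infixl \<open>$\<close> 100)

text \<open>Real matrices live in \<open>real^2^2\<close> and not in \<open>real mat\<close>,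
  because the discreteness argument uses the norm and the compactness of closed balls.\<close>

definition rmat :: "real \<Rightarrow> real \<Rightarrow> real \<Rightarrow> real \<Rightarrow> real^2^2" where
  "rmat a b c d = vector [vector [a, b], vector [c, d]]"

lemma rmat_nth [simp]:
  "rmat a b c d $ 1 $ 1 = a" "rmat a b c d $ 1 $ 2 = b"
  "rmat a b c d $ 2 $ 1 = c" "rmat a b c d $ 2 $ 2 = d"
  by (simp_all add: rmat_def)

lemma rmat_eq_iff [simp]:
  "rmat a b c d = rmat a' b' c' d' \<longleftrightarrow> a = a' \<and> b = b' \<and> c = c' \<and> d = d'"
  by (metis rmat_nth)

lemma rmat_collapse: "rmat (A $ 1 $ 1) (A $ 1 $ 2) (A $ 2 $ 1) (A $ 2 $ 2) = A"
  by (simp add: Finite_Cartesian_Product.vec_eq_iff forall_2)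

lemma rmat_cases [case_names rmat, cases type: vec]:
  obtains a b c d where "A = rmat a b c d"
  using rmat_collapse[of A] by metis

lemma rmat_mult [simp]:
  "rmat a b c d ** rmat a' b' c' d' =
     rmat (a * a' + b * c') (a * b' + b * d') (c * a' + d * c') (c * b' + d * d')"
  by (simp add: Finite_Cartesian_Product.vec_eq_iff forall_2 matrix_matrix_mult_def sum_2)

lemma scaleR_rmat [simp]: "k *\<^sub>R rmat a b c d = rmat (k * a) (k * b) (k * c) (k * d)"
  by (simp add: Finite_Cartesian_Product.vec_eq_iff forall_2)

lemma add_rmat [simp]: "rmat a b c d + rmat a' b' c' d' = rmat (a + a') (b + b') (c + c') (d + d')"
  by (simp add: Finite_Cartesian_Product.vec_eq_iff forall_2)

lemma det_rmat [simp]: "det (rmat a b c d) = a * d - b * c"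
  by (simp add: det_2)

lemma trace_rmat [simp]: "trace (rmat a b c d) = a + d"
  by (simp add: trace_def sum_2)

abbreviation smat :: "real \<Rightarrow> real^2^2" where
  "smat k \<equiv> rmat k 0 0 k"

text \<open>It stands in for the inverse without any division: the two differ by the factor det,
  which does not affect the action on the half plane.\<close>

definition adjugate :: "real^2^2 \<Rightarrow> real^2^2" where
  "adjugate A = rmat (A $ 2 $ 2) (- A $ 1 $ 2) (- A $ 2 $ 1) (A $ 1 $ 1)"

lemma adjugate_rmat [simp]: "adjugate (rmat a b c d) = rmat d (- b) (- c) a"
  by (simp add: adjugate_def)

lemma det_adjugate [simp]: "det (adjugate A) = det A"
  by (cases A) simp

lemma adjugate_mult: "adjugate A ** A = smat (det A)" "A ** adjugate A = smat (det A)"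
  by (cases A; simp add: algebra_simps)+

subsection \<open>Fractional linear transformations\<close>

text \<open>Matrices of negative determinant act through the complex conjugate, so that
  composition corresponds to the matrix product.\<close>

definition mobius :: "real^2^2 \<Rightarrow> complex \<Rightarrow> complex" where
  "mobius A z = (let w = if det A > 0 then z else cnj z in
     (of_real (A $ 1 $ 1) * w + of_real (A $ 1 $ 2)) / (of_real (A $ 2 $ 1) * w + of_real (A $ 2 $ 2)))"

lemma mobius_denominator_nonzero:
  assumes "a * d - b * c \<noteq> (0::real)" "Im w \<noteq> 0"
  shows "of_real c * w + of_real d \<noteq> 0"
proof
  assume "of_real c * w + of_real d = 0"
  then have "c * Im w = 0" "c * Re w + d = 0"
    by (auto simp: complex_eq_iff)
  with assms show False by auto
qed

lemma Im_fraction: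
  fixes a b c d :: real
  shows "Im ((of_real a * w + of_real b) / (of_real c * w + of_real d)) =
    (a * d - b * c) * Im w / (cmod (of_real c * w + of_real d))\<^sup>2"
  unfolding Im_divide cmod_power2 by (simp add: algebra_simps power2_eq_square)

text \<open>The argument is conjugated exactly when the determinant is negative, so det A and Im w
  have the same sign.\<close>

lemma mobius_in_upper_half_plane:
  assumes "det A \<noteq> 0" "z \<in> upper_half_plane"
  shows "mobius A z \<in> upper_half_plane"
proof (cases A)
  case (rmat a b c d)
  define w where "w = (if det A > 0 then z else cnj z)"
  have "(a * d - b * c) * Im w > 0" "Im w \<noteq> 0"
    using assms rmat by (auto simp: w_def upper_half_plane_def zero_less_mult_iff mult_less_0_iff)
  moreover have "mobius A z = (of_real a * w + of_real b) / (of_real c * w + of_real d)"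
    by (simp add: mobius_def w_def Let_def rmat)
  ultimately have "Im (mobius A z) > 0"
    using mobius_denominator_nonzero[of a d b c w] assms rmat by (simp add: Im_fraction)
  then show ?thesis by (simp add: upper_half_plane_def)
qed

lemma fraction_compose:
  fixes a b c d a' b' c' d' :: complex
  assumes "c' * w + d' \<noteq> 0" "(c * a' + d * c') * w + (c * b' + d * d') \<noteq> 0"
  shows "(a * ((a' * w + b') / (c' * w + d')) + b) / (c * ((a' * w + b') / (c' * w + d')) + d)
    = ((a * a' + b * c') * w + (a * b' + b * d')) / ((c * a' + d * c') * w + (c * b' + d * d'))"
proof -
  have n: "a * ((a' * w + b') / (c' * w + d')) + b =
      ((a * a' + b * c') * w + (a * b' + b * d')) / (c' * w + d')"
    "c * ((a' * w + b') / (c' * w + d')) + d =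
      ((c * a' + d * c') * w + (c * b' + d * d')) / (c' * w + d')"
    using assms(1) by (simp_all add: field_simps)
  show ?thesis
    unfolding n using assms by simp
qed

lemma mobius_mult:
  assumes "det A \<noteq> 0" "det B \<noteq> 0" "z \<in> upper_half_plane"
  shows "mobius (A ** B) z = mobius A (mobius B z)"
proof (cases A; cases B)
  fix a b c d a' b' c' d'
  assume A: "A = rmat a b c d" and B: "B = rmat a' b' c' d'"
  define w where "w = (if det (A ** B) > 0 then z else cnj z)"
  have w: "Im w \<noteq> 0" using assms(3) by (auto simp: w_def upper_half_plane_def)
  have det: "(a * a' + b * c') * (c * b' + d * d') - (a * b' + b * d') * (c * a' + d * c') \<noteq> 0"
    using assms(1,2) det_mul[of A B] unfolding A B by auto
  have "mobius (A ** B) z = (of_real (a * a' + b * c') * w + of_real (a * b' + b * d')) /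
      (of_real (c * a' + d * c') * w + of_real (c * b' + d * d'))"
    unfolding mobius_def w_def[symmetric] Let_def unfolding A B by simp
  also have "\<dots> = (of_real a * ((of_real a' * w + of_real b') / (of_real c' * w + of_real d')) + of_real b) /
      (of_real c * ((of_real a' * w + of_real b') / (of_real c' * w + of_real d')) + of_real d)"
    using mobius_denominator_nonzero[OF det w] mobius_denominator_nonzero[of a' d' b' c' w]
      assms(2) w B by (subst fraction_compose) simp_all
  \<comment> \<open>The coefficients are real, so conjugating the argument conjugates the value; the
    conjugations for A and B compose just as the signs of the determinants multiply.\<close>
  also have "(of_real a' * w + of_real b') / (of_real c' * w + of_real d') =
      (if det A > 0 then mobius B z else cnj (mobius B z))"
    using assms(1,2) by (auto simp: w_def mobius_def Let_def B det_mul zero_less_mult_iff)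
  finally show "mobius (A ** B) z = mobius A (mobius B z)"
    unfolding A by (simp add: mobius_def[of "rmat a b c d"] Let_def if_distrib)
qed

lemma mobius_scaleR:
  assumes "k \<noteq> 0"
  shows "mobius (k *\<^sub>R A) = mobius A"
proof (cases A)
  case (rmat a b c d)
  have "det (k *\<^sub>R A) = k\<^sup>2 * det A"
    by (simp add: rmat power2_eq_square algebra_simps)
  then have "det (k *\<^sub>R A) > 0 \<longleftrightarrow> det A > 0"
    using assms by (simp add: zero_less_mult_iff)
  moreover have "(of_real (k * a) * w + of_real (k * b)) / (of_real (k * c) * w + of_real (k * d)) =
      (of_real a * w + of_real b) / (of_real c * w + of_real d)" for w :: complex
  proof -
    have "of_real (k * x) * w + of_real (k * y) = of_real k * (of_real x * w + of_real y)" for x y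
      by (simp add: algebra_simps)
    then show ?thesis using assms by simp
  qed
  ultimately show ?thesis
    by (auto simp: mobius_def fun_eq_iff rmat Let_def)
qed

lemma mobius_smat [simp]: "k \<noteq> 0 \<Longrightarrow> mobius (smat k) z = z"
  by (auto simp: mobius_def zero_less_mult_iff)

lemma mobius_eq_id_imp_scalar:
  assumes "det A \<noteq> 0" "\<And>z. z \<in> upper_half_plane \<Longrightarrow> mobius A z = z"
  shows "\<exists>k. A = smat k"
proof (cases A)
  case (rmat a b c d)
  define \<sigma> :: "complex \<Rightarrow> complex" where "\<sigma> = (if det A > 0 then (\<lambda>z. z) else cnj)"
  have eq: "of_real a * \<sigma> z + of_real b = z * (of_real c * \<sigma> z + of_real d)" if "z \<in> upper_half_plane" for z
  proof -
    have "of_real c * \<sigma> z + of_real d \<noteq> 0"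
      using assms(1) rmat that
      by (intro mobius_denominator_nonzero[of a d b c]) (auto simp: \<sigma>_def upper_half_plane_def)
    with assms(2)[OF that] show ?thesis
      by (auto simp: mobius_def \<sigma>_def rmat Let_def field_simps split: if_splits)
  qed
  have "\<i> \<in> upper_half_plane" "2 * \<i> \<in> upper_half_plane" "1 + \<i> \<in> upper_half_plane"
    by (auto simp: upper_half_plane_def)
  note e = eq[OF this(1)] eq[OF this(2)] eq[OF this(3)]
  \<comment> \<open>For negative determinant the three equations leave only the zero matrix, so this
    conclusion covers both signs.\<close>
  have "b = 0 \<and> c = 0 \<and> a = d"
    using e by (cases "det A > 0") (auto simp: \<sigma>_def complex_eq_iff)
  then show ?thesis
    by (auto simp: rmat )
qed

lemma mobius_adjugate:
  assumes "det A \<noteq> 0" "z \<in> upper_half_plane"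
  shows "mobius (adjugate A) (mobius A z) = z" "mobius A (mobius (adjugate A) z) = z"
  using assms mobius_mult[of "adjugate A" A z] mobius_mult[of A "adjugate A" z]
  by (simp_all add: adjugate_mult)

lemma mobius_eq_imp_proportional:
  assumes "det A \<noteq> 0" "det B \<noteq> 0" "\<And>z. z \<in> upper_half_plane \<Longrightarrow> mobius A z = mobius B z"
  shows "\<exists>k. k \<noteq> 0 \<and> A = k *\<^sub>R B"
proof -
  have "mobius (adjugate B ** A) z = z" if "z \<in> upper_half_plane" for z
    using mobius_mult[of "adjugate B" A z] mobius_adjugate(1)[of B z] assms that by simp
  then obtain k where k: "adjugate B ** A = smat k"
    using mobius_eq_id_imp_scalar[of "adjugate B ** A"] assms(1,2) by (auto simp: det_mul)
  have "B ** (adjugate B ** A) = det B *\<^sub>R A"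
    unfolding matrix_mul_assoc adjugate_mult by (cases A) simp
  moreover have "B ** smat k = k *\<^sub>R B"
    by (cases B) (simp add: algebra_simps)
  ultimately have "det B *\<^sub>R A = k *\<^sub>R B"
    using k by simp
  then have "(1 / det B) *\<^sub>R (det B *\<^sub>R A) = (1 / det B) *\<^sub>R (k *\<^sub>R B)"
    by simp
  then have "A = (k / det B) *\<^sub>R B"
    using assms(2) by simp
  moreover have "k \<noteq> 0"
  proof
    assume "k = 0"
    with calculation have "A = 0" by simp
    then show False using assms(1) by (simp add: det_2)
  qed
  ultimately show ?thesis using assms(2) by (intro exI[of _ "k / det B"]) simp
qed

subsection \<open>Classification of isometries\<close>

text \<open>\<open>hyperbolic_dist z w = arcosh (1 + sep z w / 2)\<close>\<close>

definition sep :: "complex \<Rightarrow> complex \<Rightarrow> real" where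
  "sep z w = (cmod (z - w))\<^sup>2 / (Im z * Im w)"

lemma sep_isometry:
  assumes "f \<in> hyperbolic_isometries" "z \<in> upper_half_plane" "w \<in> upper_half_plane"
  shows "sep (f z) (f w) = sep z w"
proof -
  have "cosh (hyperbolic_dist x y) = 1 + sep x y / 2" if "x \<in> upper_half_plane" "y \<in> upper_half_plane" for x y
    using that by (simp add: hyperbolic_dist_def sep_def cosh_arcosh_real upper_half_plane_def mult_ac)
  moreover have "f z \<in> upper_half_plane" "f w \<in> upper_half_plane"
    using assms Bij_imp_funcset[of f upper_half_plane] by (auto simp: hyperbolic_isometries_def)
  moreover have "hyperbolic_dist (f z) (f w) = hyperbolic_dist z w"
    using assms by (auto simp: hyperbolic_isometries_def)
  ultimately show ?thesis
    using assms by (metis add_left_cancel divide_cancel_right zero_neq_numeral)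
qed

text \<open>The squared distance and the product of the imaginary parts both acquire the factor
  det^2 divided by the squared absolute values of the two denominators.\<close>

lemma sep_mobius:
  assumes "det A \<noteq> 0" "z \<in> upper_half_plane" "w \<in> upper_half_plane"
  shows "sep (mobius A z) (mobius A w) = sep z w"
proof (cases A)
  case (rmat a b c d)
  define \<sigma> :: "complex \<Rightarrow> complex" where "\<sigma> = (if det A > 0 then (\<lambda>z. z) else cnj)"
  let ?D = "a * d - b * c"
  let ?j = "\<lambda>z. of_real c * \<sigma> z + of_real d :: complex"
  have m: "mobius A z = (of_real a * \<sigma> z + of_real b) / ?j z" for z
    by (simp add: mobius_def rmat \<sigma>_def Let_def)
  have D: "?D \<noteq> 0" using assms(1) rmat by simp
  have j: "?j x \<noteq> 0" if "x \<in> upper_half_plane" for x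
    using D that by (intro mobius_denominator_nonzero[of a d b c]) (auto simp: \<sigma>_def upper_half_plane_def)
  have "mobius A z - mobius A w = of_real ?D * (\<sigma> z - \<sigma> w) / (?j z * ?j w)"
    unfolding m using j[OF assms(2)] j[OF assms(3)] by (simp add: field_simps)
  moreover have "cmod (\<sigma> z - \<sigma> w) = cmod (z - w)"
    unfolding \<sigma>_def using complex_mod_cnj[of "z - w"] by simp
  ultimately have n: "(cmod (mobius A z - mobius A w))\<^sup>2 = ?D\<^sup>2 * (cmod (z - w))\<^sup>2 / ((cmod (?j z))\<^sup>2 * (cmod (?j w))\<^sup>2)"
    by (simp add: norm_mult norm_divide power_mult_distrib power_divide power2_abs del: of_real_diff of_real_mult)
  have i: "Im (mobius A x) = ?D * Im (\<sigma> x) / (cmod (?j x))\<^sup>2" for x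
    unfolding m by (rule Im_fraction)
  have "Im (\<sigma> z) * Im (\<sigma> w) = Im z * Im w"
    by (simp add: \<sigma>_def)
  then have i2: "Im (mobius A z) * Im (mobius A w) = ?D\<^sup>2 * (Im z * Im w) / ((cmod (?j z))\<^sup>2 * (cmod (?j w))\<^sup>2)"
    unfolding i by (simp add: power2_eq_square field_simps)
  have "(cmod (?j z))\<^sup>2 * (cmod (?j w))\<^sup>2 \<noteq> 0"
    using j[OF assms(2)] j[OF assms(3)] by simp
  then show ?thesis
    unfolding sep_def n i2 using D by (simp add: field_simps)
qed

text \<open>The reflection in the perpendicular bisector of \<open>z\<close> and \<open>w\<close>.\<close>

definition bisector :: "complex \<Rightarrow> complex \<Rightarrow> real^2^2" where
  "bisector z w = (let v = Re z * Im w - Re w * Im z;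
     u = (cmod z)\<^sup>2 * Im w - (cmod w)\<^sup>2 * Im z in rmat v (- u) (Im w - Im z) (- v))"

lemma det_bisector: "det (bisector z w) = - (Im z * Im w * (cmod (z - w))\<^sup>2)"
  unfolding bisector_def Let_def det_rmat cmod_power2
  by (simp add: algebra_simps power2_eq_square)

text \<open>The last hypothesis is the desired equation with its denominator cleared, which leaves
  polynomial identities for the fixed and the exchanged points.\<close>

lemma mobius_bisector:
  assumes "z \<in> upper_half_plane" "w \<in> upper_half_plane" "z \<noteq> w" "p \<in> upper_half_plane"
    and "(of_real (Re z * Im w - Re w * Im z) * cnj p - of_real ((cmod z)\<^sup>2 * Im w - (cmod w)\<^sup>2 * Im z)) =
      q * (of_real (Im w - Im z) * cnj p - of_real (Re z * Im w - Re w * Im z))"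
  shows "mobius (bisector z w) p = q"
proof -
  define v u s where "v = Re z * Im w - Re w * Im z" and "u = (cmod z)\<^sup>2 * Im w - (cmod w)\<^sup>2 * Im z"
    and "s = Im w - Im z"
  have b: "bisector z w = rmat v (- u) s (- v)"
    by (simp add: bisector_def v_def u_def s_def Let_def)
  have "det (bisector z w) < 0"
    using assms unfolding det_bisector by (auto simp: upper_half_plane_def)
  then have d: "v * (- v) - (- u) * s < 0"
    unfolding b by simp
  then have "of_real s * cnj p + of_real (- v) \<noteq> 0"
    using assms(4) by (intro mobius_denominator_nonzero[of v "- v" "- u" s]) (auto simp: upper_half_plane_def)
  moreover have "of_real v * cnj p + of_real (- u) = q * (of_real s * cnj p + of_real (- v))"
    using assms(5)[folded v_def u_def s_def] by simp
  ultimately have "(of_real v * cnj p + of_real (- u)) / (of_real s * cnj p + of_real (- v)) = q"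
    by (metis nonzero_mult_div_cancel_right)
  then show ?thesis
    using d unfolding b by (simp add: mobius_def Let_def)
qed

lemma mobius_bisector_fix:
  assumes "z \<in> upper_half_plane" "w \<in> upper_half_plane" "z \<noteq> w" "p \<in> upper_half_plane" "sep p z = sep p w"
  shows "mobius (bisector z w) p = p"
proof (rule mobius_bisector[OF assms(1-4)])
  have "(cmod (p - z))\<^sup>2 * Im w = (cmod (p - w))\<^sup>2 * Im z"
    using assms by (simp add: sep_def upper_half_plane_def field_simps)
  then have "((Re p - Re z)\<^sup>2 + (Im p - Im z)\<^sup>2) * Im w = ((Re p - Re w)\<^sup>2 + (Im p - Im w)\<^sup>2) * Im z"
    by (simp add: cmod_power2)
  then show "of_real (Re z * Im w - Re w * Im z) * cnj p - of_real ((cmod z)\<^sup>2 * Im w - (cmod w)\<^sup>2 * Im z) =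
      p * (of_real (Im w - Im z) * cnj p - of_real (Re z * Im w - Re w * Im z))"
    unfolding complex_eq_iff cmod_power2 by (simp add: power2_eq_square algebra_simps)
qed

lemma mobius_bisector_swap:
  assumes "z \<in> upper_half_plane" "w \<in> upper_half_plane" "z \<noteq> w"
  shows "mobius (bisector z w) z = w"
proof (rule mobius_bisector[OF assms assms(1)])
  show "of_real (Re z * Im w - Re w * Im z) * cnj z - of_real ((cmod z)\<^sup>2 * Im w - (cmod w)\<^sup>2 * Im z) =
      w * (of_real (Im w - Im z) * cnj z - of_real (Re z * Im w - Re w * Im z))"
    unfolding complex_eq_iff cmod_power2 by (simp add: power2_eq_square algebra_simps)
qed

text \<open>A point is determined by its distances from three points not on one geodesic: \<i> and 2
  \<i> lie on the imaginary axis, 1 + \<i> does not. For x + y \<i>, the three values are affine in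
  1/y, m/y and x/y with m = x^2 + y^2.\<close>

lemma sep_eqI:
  assumes "p \<in> upper_half_plane" "q \<in> upper_half_plane"
    "sep p \<i> = sep q \<i>" "sep p (2 * \<i>) = sep q (2 * \<i>)" "sep p (1 + \<i>) = sep q (1 + \<i>)"
  shows "p = q"
proof -
  obtain x y x' y' where xy: "p = Complex x y" "q = Complex x' y'"
    by (metis complex_surj)
  have y: "y > 0" "y' > 0" using assms xy by (auto simp: upper_half_plane_def)
  define m m' where "m = x\<^sup>2 + y\<^sup>2" and "m' = x'\<^sup>2 + y'\<^sup>2"
  have "(m + 1 - 2 * y) / y = (m' + 1 - 2 * y') / y'" "(m + 4 - 4 * y) / (2 * y) = (m' + 4 - 4 * y') / (2 * y')"
    "(m + 2 - 2 * x - 2 * y) / y = (m' + 2 - 2 * x' - 2 * y') / y'"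
    using assms(3-5) unfolding sep_def cmod_power2 xy m_def m'_def
    by (simp_all add: power2_eq_square algebra_simps)
  then have "(m + 1) * y' = (m' + 1) * y" "(m + 4) * y' = (m' + 4) * y" "(m + 2 - 2 * x) * y' = (m' + 2 - 2 * x') * y"
    using y by (simp_all add: field_simps)
  then have "y = y'" by (simp add: algebra_simps)
  with \<open>(m + 1) * y' = (m' + 1) * y\<close> y have "m = m'" by simp
  with \<open>(m + 2 - 2 * x) * y' = (m' + 2 - 2 * x') * y\<close> \<open>y = y'\<close> y have "x = x'" by simp
  with \<open>y = y'\<close> xy show ?thesis by simp
qed

text \<open>The reflection in the bisector fixes every point equidistant from z and w, so a new
  point can be put in place without disturbing those already placed.\<close>

lemma exists_mobius_moving:
  assumes "z \<in> upper_half_plane" "w \<in> upper_half_plane" "\<And>p. p \<in> P \<Longrightarrow> p \<in> upper_half_plane \<and> sep p z = sep p w"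
  shows "\<exists>A. det A \<noteq> 0 \<and> mobius A z = w \<and> (\<forall>p\<in>P. mobius A p = p)"
proof (cases "z = w")
  case True
  then show ?thesis by (intro exI[of _ "smat 1"]) simp
next
  case False
  moreover from this have "det (bisector z w) \<noteq> 0"
    using assms(1,2) by (simp add: det_bisector upper_half_plane_def)
  ultimately show ?thesis
    using assms by (intro exI[of _ "bisector z w"]) (auto simp: mobius_bisector_swap mobius_bisector_fix)
qed

text \<open>Every isometry is a product of at most three reflections: they bring the images of \<i>,
  2 \<i> and 1 + \<i> back one after the other, and a map preserving distances and fixing these
  points is the identity.\<close>

lemma isometry_is_mobius:
  assumes "\<And>z. z \<in> upper_half_plane \<Longrightarrow> f z \<in> upper_half_plane"
    and "\<And>z w. z \<in> upper_half_plane \<Longrightarrow> w \<in> upper_half_plane \<Longrightarrow> sep (f z) (f w) = sep z w"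
  shows "\<exists>A. det A \<noteq> 0 \<and> (\<forall>z\<in>upper_half_plane. f z = mobius A z)"
proof -
  have sep_commute: "sep z w = sep w z" for z w
    by (simp add: sep_def norm_minus_commute mult.commute)
  have H: "\<i> \<in> upper_half_plane" "2 * \<i> \<in> upper_half_plane" "1 + \<i> \<in> upper_half_plane"
    by (auto simp: upper_half_plane_def)
  obtain A where A: "det A \<noteq> 0" "mobius A (f \<i>) = \<i>"
    using exists_mobius_moving[of "f \<i>" \<i> "{}"] H assms(1) by auto
  define g where "g = (\<lambda>z. mobius A (f z))"
  have g: "\<And>z. z \<in> upper_half_plane \<Longrightarrow> g z \<in> upper_half_plane"
    "\<And>z w. z \<in> upper_half_plane \<Longrightarrow> w \<in> upper_half_plane \<Longrightarrow> sep (g z) (g w) = sep z w" "g \<i> = \<i>"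
    using A assms by (auto simp: g_def mobius_in_upper_half_plane sep_mobius)
  obtain B where B: "det B \<noteq> 0" "mobius B (g (2 * \<i>)) = 2 * \<i>" "mobius B \<i> = \<i>"
    using exists_mobius_moving[of "g (2 * \<i>)" "2 * \<i>" "{\<i>}"] H g(1) g(2)[of \<i> "2 * \<i>"] g(3) by auto
  define h where "h = (\<lambda>z. mobius B (g z))"
  have h: "\<And>z. z \<in> upper_half_plane \<Longrightarrow> h z \<in> upper_half_plane"
    "\<And>z w. z \<in> upper_half_plane \<Longrightarrow> w \<in> upper_half_plane \<Longrightarrow> sep (h z) (h w) = sep z w"
    "h \<i> = \<i>" "h (2 * \<i>) = 2 * \<i>"
    using B g by (auto simp: h_def mobius_in_upper_half_plane sep_mobius)
  obtain C where C: "det C \<noteq> 0" "mobius C (h (1 + \<i>)) = 1 + \<i>" "mobius C \<i> = \<i>" "mobius C (2 * \<i>) = 2 * \<i>"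
    using exists_mobius_moving[of "h (1 + \<i>)" "1 + \<i>" "{\<i>, 2 * \<i>}"] H h(1)
      h(2)[of \<i> "1 + \<i>"] h(2)[of "2 * \<i>" "1 + \<i>"] h(3,4) by auto
  define k where "k = (\<lambda>z. mobius C (h z))"
  have k: "\<And>z. z \<in> upper_half_plane \<Longrightarrow> k z \<in> upper_half_plane"
    "\<And>z w. z \<in> upper_half_plane \<Longrightarrow> w \<in> upper_half_plane \<Longrightarrow> sep (k z) (k w) = sep z w"
    "k \<i> = \<i>" "k (2 * \<i>) = 2 * \<i>" "k (1 + \<i>) = 1 + \<i>"
    using C h by (auto simp: k_def mobius_in_upper_half_plane sep_mobius)
  have k_id: "k z = z" if "z \<in> upper_half_plane" for z
    using k(2)[OF that H(1)] k(2)[OF that H(2)] k(2)[OF that H(3)] k(3-5) k(1) that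
    by (intro sep_eqI) auto
  let ?M = "C ** (B ** A)"
  have M: "det ?M \<noteq> 0" using A B C by (simp add: det_mul)
  have "mobius ?M (f z) = z" if "z \<in> upper_half_plane" for z
    using k_id[OF that] A(1) B(1) C(1) assms(1)[OF that]
    by (simp add: k_def h_def g_def mobius_mult det_mul mobius_in_upper_half_plane)
  then have "f z = mobius (adjugate ?M) z" if "z \<in> upper_half_plane" for z
    using mobius_adjugate(1)[OF M assms(1)[OF that]] that by simp
  with M show ?thesis
    by (intro exI[of _ "adjugate ?M"]) simp
qed

subsection \<open>Fuchsian groups as groups of matrices\<close>

text \<open>Elements of \<open>BijGroup\<close> are \<open>undefined\<close> off the half plane,
  hence \<open>restrict\<close>. The determinant is left free so that matrices may be
  rescaled.\<close>

definition realizes :: "real^2^2 \<Rightarrow> (complex \<Rightarrow> complex) \<Rightarrow> bool" where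
  "realizes A f \<longleftrightarrow> det A \<noteq> 0 \<and> f = restrict (mobius A) upper_half_plane"

lemma realizes_unique:
  assumes "realizes A f" "realizes B f"
  obtains k where "k \<noteq> 0" "A = k *\<^sub>R B"
proof -
  have "mobius A z = mobius B z" if "z \<in> upper_half_plane" for z
    using assms that by (metis realizes_def restrict_apply')
  then show thesis
    using mobius_eq_imp_proportional[of A B] assms that unfolding realizes_def by blast
qed

lemma det_scaleR_2: "det (k *\<^sub>R A :: real^2^2) = k\<^sup>2 * det A"
  by (cases A) (simp add: power2_eq_square algebra_simps)

lemma realizes_scaleR: "realizes A f \<Longrightarrow> k \<noteq> 0 \<Longrightarrow> realizes (k *\<^sub>R A) f"
  by (simp add: realizes_def mobius_scaleR det_scaleR_2)

lemma realizes_inj: "realizes A f \<Longrightarrow> realizes A g \<Longrightarrow> f = g"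
  by (simp add: realizes_def)

lemma one_BijGroup: "\<one>\<^bsub>BijGroup S\<^esub> = (\<lambda>x\<in>S. x)"
  by (simp add: BijGroup_def)

lemma realizes_one_iff: "realizes A \<one>\<^bsub>BijGroup upper_half_plane\<^esub> \<longleftrightarrow> (\<exists>k. k \<noteq> 0 \<and> A = smat k)"
proof
  assume A: "realizes A \<one>\<^bsub>BijGroup upper_half_plane\<^esub>"
  then have "mobius A z = z" if "z \<in> upper_half_plane" for z
    using that unfolding realizes_def one_BijGroup by (metis restrict_apply')
  then show "\<exists>k. k \<noteq> 0 \<and> A = smat k"
    using mobius_eq_id_imp_scalar[of A] A by (force simp: realizes_def)
next
  assume "\<exists>k. k \<noteq> 0 \<and> A = smat k"
  then show "realizes A \<one>\<^bsub>BijGroup upper_half_plane\<^esub>"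
    by (auto simp: realizes_def one_BijGroup)
qed

locale fuchsian =
  fixes \<Delta> :: "(complex \<Rightarrow> complex) set"
  assumes fuchsian: "fuchsian_group \<Delta>"
begin

abbreviation "G \<equiv> isometry_group \<Delta>"

lemma subgroup_\<Delta>: "subgroup \<Delta> (BijGroup upper_half_plane)"
  using fuchsian by (simp add: fuchsian_group_def)

sublocale group G
  by (rule group.subgroup_imp_group[OF group_BijGroup subgroup_\<Delta>])

lemma in_Bij: "f \<in> \<Delta> \<Longrightarrow> f \<in> Bij upper_half_plane"
  using subgroup.subset[OF subgroup_\<Delta>] by (auto simp: BijGroup_def)

lemma maps_to: "f \<in> \<Delta> \<Longrightarrow> z \<in> upper_half_plane \<Longrightarrow> f z \<in> upper_half_plane"
  using Bij_imp_funcset[OF in_Bij] by auto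

lemma mult_eq: "f \<in> \<Delta> \<Longrightarrow> g \<in> \<Delta> \<Longrightarrow> f \<otimes>\<^bsub>G\<^esub> g = compose upper_half_plane f g"
  by (simp add: BijGroup_def in_Bij)

lemma mult_apply: "f \<in> \<Delta> \<Longrightarrow> g \<in> \<Delta> \<Longrightarrow> z \<in> upper_half_plane \<Longrightarrow> (f \<otimes>\<^bsub>G\<^esub> g) z = f (g z)"
  by (simp only: mult_eq compose_eq)

lemma one_apply: "z \<in> upper_half_plane \<Longrightarrow> \<one>\<^bsub>G\<^esub> z = z"
  by (simp add: one_BijGroup)

lemma realizes_mult:
  assumes "f \<in> \<Delta>" "g \<in> \<Delta>" "realizes A f" "realizes B g"
  shows "realizes (A ** B) (f \<otimes>\<^bsub>G\<^esub> g)"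
  unfolding realizes_def mult_eq[OF assms(1,2)]
proof (intro conjI ext)
  show "det (A ** B) \<noteq> 0"
    using assms by (simp add: det_mul realizes_def)
  show "compose upper_half_plane f g z = restrict (mobius (A ** B)) upper_half_plane z" for z
    using assms by (simp add: compose_def realizes_def mobius_mult mobius_in_upper_half_plane)
qed

lemma realizable:
  assumes "f \<in> \<Delta>"
  obtains A where "realizes A f" "\<bar>det A\<bar> = 1"
proof -
  have f: "f \<in> hyperbolic_isometries"
    using fuchsian assms by (auto simp: fuchsian_group_def)
  obtain A where A: "det A \<noteq> 0" "\<And>z. z \<in> upper_half_plane \<Longrightarrow> f z = mobius A z"
    using isometry_is_mobius[of f] maps_to[OF assms] sep_isometry[OF f] by auto
  have "f = restrict (mobius A) upper_half_plane"
    using A(2) Bij_imp_extensional[OF in_Bij[OF assms]] by (auto simp: restrict_def extensional_def)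
  with A(1) have "realizes A f" by (simp add: realizes_def)
  define k where "k = 1 / sqrt \<bar>det A\<bar>"
  have k: "k \<noteq> 0" "k\<^sup>2 * \<bar>det A\<bar> = 1"
    using A(1) by (auto simp: k_def power_divide)
  then have "\<bar>det (k *\<^sub>R A)\<bar> = 1"
    by (simp add: det_scaleR_2 abs_mult)
  with that realizes_scaleR[OF \<open>realizes A f\<close> k(1)] show thesis by blast
qed

lemma realizes_inv:
  assumes "f \<in> \<Delta>" "realizes A f"
  shows "realizes (adjugate A) (inv\<^bsub>G\<^esub> f)"
proof -
  have inv: "inv\<^bsub>G\<^esub> f \<in> \<Delta>"
    using inv_closed[of f] assms(1) by simp
  obtain B where B: "realizes B (inv\<^bsub>G\<^esub> f)"
    using realizable[OF inv] by blast
  have "inv\<^bsub>G\<^esub> f \<otimes>\<^bsub>G\<^esub> f = \<one>\<^bsub>G\<^esub>"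
    using l_inv[of f] assms(1) by simp
  then have "realizes (B ** A) \<one>\<^bsub>BijGroup upper_half_plane\<^esub>"
    using realizes_mult[OF inv assms(1) B assms(2)] by simp
  then obtain k where k: "k \<noteq> 0" "B ** A = smat k"
    by (auto simp: realizes_one_iff)
  have "det A *\<^sub>R B = B ** (A ** adjugate A)"
    unfolding adjugate_mult by (cases B) (simp add: mult.commute)
  also have "\<dots> = k *\<^sub>R adjugate A"
    unfolding matrix_mul_assoc k(2) by (cases A) simp
  finally have "det A *\<^sub>R B = k *\<^sub>R adjugate A" .
  moreover have "realizes (det A *\<^sub>R B) (inv\<^bsub>G\<^esub> f)"
    using assms(2) B by (intro realizes_scaleR) (auto simp: realizes_def)
  ultimately have "realizes (k *\<^sub>R adjugate A) (inv\<^bsub>G\<^esub> f)"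
    by simp
  from realizes_scaleR[OF this, of "inverse k"] k(1) show ?thesis by simp
qed

text \<open>The square of A is scalar, so by Cayley-Hamilton (tr A) A is scalar. With nonzero trace
  A itself would be scalar and s the identity.\<close>

lemma involution_trace:
  assumes "s \<in> involutions G" "realizes A s"
  shows "trace A = 0"
proof (cases A)
  case (rmat a b c d)
  have s: "s \<in> \<Delta>" "s \<noteq> \<one>\<^bsub>G\<^esub>" "s \<otimes>\<^bsub>G\<^esub> s = \<one>\<^bsub>G\<^esub>"
    using assms(1) involutions_iff by auto
  have "\<exists>k. k \<noteq> 0 \<and> A ** A = smat k"
    using realizes_mult[OF s(1) s(1) assms(2) assms(2)] s(3) realizes_one_iff by simp
  then have e: "a * b + b * d = 0" "c * a + d * c = 0" "a * a + b * c = c * b + d * d"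
    by (auto simp: rmat)
  show ?thesis
  proof (rule ccontr)
    assume "trace A \<noteq> 0"
    then have t: "a + d \<noteq> 0" by (simp add: rmat)
    have "(a + d) * b = 0" "(a + d) * c = 0" "(a + d) * (a - d) = 0"
      using e by (simp_all add: algebra_simps)
    with t have A: "A = smat a" by (simp add: rmat)
    moreover have "a \<noteq> 0"
      using assms(2) A by (auto simp: realizes_def)
    ultimately have "realizes A \<one>\<^bsub>G\<^esub>"
      using realizes_one_iff by simp
    with assms(2) s(2) realizes_inj show False by blast
  qed
qed

subsection \<open>Elements of infinite order\<close>

text \<open>By Cayley-Hamilton the powers of \<open>C\<close> have the form \<open>u C + v\<close>, and \<open>\<bar>v\<bar> < \<bar>u\<bar>\<close> is
  preserved by \<open>(u, v) \<mapsto> (u tr C + v, - u)\<close>.\<close>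

lemma infinite_order:
  assumes "f \<in> \<Delta>" "realizes C f" "det C = 1" "\<bar>trace C\<bar> \<ge> 2" "f \<noteq> \<one>\<^bsub>G\<^esub>" "n \<noteq> (0::nat)"
  shows "f [^]\<^bsub>G\<^esub> n \<noteq> \<one>\<^bsub>G\<^esub>"
proof -
  have pow: "\<exists>u v. \<bar>u\<bar> > \<bar>v\<bar> \<and> realizes (u *\<^sub>R C + smat v) (f [^]\<^bsub>G\<^esub> Suc n)" for n
  proof (induction n)
    case 0
    have "realizes (1 *\<^sub>R C + smat 0) (f [^]\<^bsub>G\<^esub> Suc 0)"
      using assms(1,2) l_one[of f] by (cases C) simp
    then show ?case by (intro exI[of _ 1] exI[of _ 0]) simp
  next
    case (Suc n)
    then obtain u v where uv: "\<bar>u\<bar> > \<bar>v\<bar>" "realizes (u *\<^sub>R C + smat v) (f [^]\<^bsub>G\<^esub> Suc n)"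
      by blast
    have "f [^]\<^bsub>G\<^esub> Suc n \<in> \<Delta>"
      using nat_pow_closed[of f "Suc n"] assms(1) by simp
    from realizes_mult[OF this assms(1) uv(2) assms(2)]
    have "realizes ((u *\<^sub>R C + smat v) ** C) (f [^]\<^bsub>G\<^esub> Suc (Suc n))"
      by (simp only: nat_pow_Suc)
    moreover have "(u *\<^sub>R C + smat v) ** C = (u * trace C + v) *\<^sub>R C + smat (- u)"
    proof (cases C)
      case (rmat a b c d)
      then have "a * d = 1 + b * c" using assms(3) by simp
      then have "u * (a * d) = u * (1 + b * c)" by simp
      then show ?thesis
        by (simp add: rmat algebra_simps)
    qed
    \<comment> \<open>The left side is at least 2 |u| - |v| > |u|, so the parabolic case of trace 2
      or -2 is included.\<close>
    moreover have "\<bar>u * trace C + v\<bar> > \<bar>- u\<bar>"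
    proof -
      have "\<bar>u * trace C\<bar> \<ge> \<bar>u\<bar> * 2"
        unfolding abs_mult using assms(4) by (intro mult_left_mono) auto
      with uv(1) show ?thesis by linarith
    qed
    ultimately show ?case by metis
  qed
  obtain m where m: "n = Suc m" using assms(6) not0_implies_Suc by blast
  obtain u v where uv: "\<bar>u\<bar> > \<bar>v\<bar>" "realizes (u *\<^sub>R C + smat v) (f [^]\<^bsub>G\<^esub> n)"
    using pow[of m] m by blast
  show ?thesis
  proof
    assume "f [^]\<^bsub>G\<^esub> n = \<one>\<^bsub>G\<^esub>"
    with uv obtain k where k: "u *\<^sub>R C + smat v = smat k"
      using realizes_one_iff by auto
    have "u \<noteq> 0" using uv(1) by auto
    have "\<exists>a. C = smat a"
      using k \<open>u \<noteq> 0\<close> by (cases C) auto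
    then obtain a where "C = smat a" by blast
    moreover from this have "a \<noteq> 0" using assms(3) by auto
    ultimately have "realizes C \<one>\<^bsub>G\<^esub>"
      using realizes_one_iff by simp
    with assms(2,5) realizes_inj show False by blast
  qed
qed

lemma not_Borel_property_if_trace:
  assumes "s \<in> involutions G" "t \<in> involutions G" "s \<noteq> t" "realizes A s" "realizes B t"
    and "det A * det B = 1" "\<bar>trace (A ** B)\<bar> \<ge> 2"
  shows "\<not> Borel_property G"
proof -
  have s: "s \<in> \<Delta>" "s \<otimes>\<^bsub>G\<^esub> s = \<one>\<^bsub>G\<^esub>" and t: "t \<in> \<Delta>" "t \<otimes>\<^bsub>G\<^esub> t = \<one>\<^bsub>G\<^esub>"
    using assms(1,2) involutions_iff by auto
  have "s \<otimes>\<^bsub>G\<^esub> t \<noteq> \<one>\<^bsub>G\<^esub>"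
    using s t assms(3) r_cancel[of s t t] by auto
  moreover have "s \<otimes>\<^bsub>G\<^esub> t \<in> \<Delta>"
    using m_closed[of s t] s t by simp
  moreover have "det (A ** B) = 1"
    using assms(6) by (simp add: det_mul)
  ultimately have "(s \<otimes>\<^bsub>G\<^esub> t) [^]\<^bsub>G\<^esub> n \<noteq> \<one>\<^bsub>G\<^esub>" if "n \<noteq> 0" for n :: nat
    using realizes_mult[OF s(1) t(1) assms(4,5)] assms(7) that by (intro infinite_order)
  then show ?thesis
    using s t is_group by (intro not_Borel_property_if_involutions[of G s t]) simp_all
qed

end

subsection \<open>Discreteness\<close>

text \<open>The determinant k^2 of a scalar matrix is positive, so nearby matrices act without
  conjugation, by a fraction continuous in the entries.\<close>

lemma eventually_mobius_in_open:
  assumes "open V" "z \<in> V" "z \<in> upper_half_plane" "k \<noteq> 0"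
  shows "eventually (\<lambda>C. mobius C z \<in> V) (nhds (smat k))"
proof -
  let ?f = "\<lambda>C :: real^2^2. (of_real (C $ 1 $ 1) * z + of_real (C $ 1 $ 2)) / (of_real (C $ 2 $ 1) * z + of_real (C $ 2 $ 2))"
  have id: "((\<lambda>C. C) \<longlongrightarrow> smat k) (nhds (smat k))"
    by (rule filterlim_ident)
  have "(?f \<longlongrightarrow> ?f (smat k)) (nhds (smat k))"
    using assms(4) by (intro tendsto_intros id) simp
  then have "(?f \<longlongrightarrow> z) (nhds (smat k))"
    using assms(4) by simp
  then have "eventually (\<lambda>C. ?f C \<in> V) (nhds (smat k))"
    using assms(1,2) by (rule topological_tendstoD)
  moreover have "((\<lambda>C. det C) \<longlongrightarrow> det (smat k)) (nhds (smat k))"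
    unfolding det_2 by (intro tendsto_intros id)
  then have "eventually (\<lambda>C. det C > 0) (nhds (smat k))"
    using assms(4) by (intro order_tendstoD(1)[where y = "det (smat k)"]) (auto simp: zero_less_mult_iff)
  ultimately show ?thesis
    by eventually_elim (simp add: mobius_def)
qed

lemma tendsto_rmat:
  assumes "(f \<longlongrightarrow> a) F" "(g \<longlongrightarrow> b) F" "(h \<longlongrightarrow> c) F" "(k \<longlongrightarrow> d) F"
  shows "((\<lambda>x. rmat (f x) (g x) (h x) (k x)) \<longlongrightarrow> rmat a b c d) F"
proof (intro vec_tendstoI)
  fix i j :: 2
  show "((\<lambda>x. rmat (f x) (g x) (h x) (k x) $ i $ j) \<longlongrightarrow> rmat a b c d $ i $ j) F"
    using exhaust_2[of i] exhaust_2[of j] assms by auto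
qed

text \<open>Two matrices close to a common limit have a quotient close to a scalar, that is, one
  acting almost as the identity.\<close>

lemma tendsto_adjugate_mult:
  "((\<lambda>(A, B). adjugate A ** B) \<longlongrightarrow> smat (det L)) (nhds L \<times>\<^sub>F nhds L)"
proof -
  have adj: "adjugate A ** B =
      rmat (A $ 2 $ 2 * B $ 1 $ 1 - A $ 1 $ 2 * B $ 2 $ 1) (A $ 2 $ 2 * B $ 1 $ 2 - A $ 1 $ 2 * B $ 2 $ 2)
        (A $ 1 $ 1 * B $ 2 $ 1 - A $ 2 $ 1 * B $ 1 $ 1) (A $ 1 $ 1 * B $ 2 $ 2 - A $ 2 $ 1 * B $ 1 $ 2)"
    for A B by (cases A; cases B) simp
  have 1: "((\<lambda>x. fst x) \<longlongrightarrow> L) (nhds L \<times>\<^sub>F nhds L)" "((\<lambda>x. snd x) \<longlongrightarrow> L) (nhds L \<times>\<^sub>F nhds L)"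
    by (rule filterlim_fst filterlim_snd)+
  have "((\<lambda>x. adjugate (fst x) ** snd x) \<longlongrightarrow> adjugate L ** L) (nhds L \<times>\<^sub>F nhds L)"
    unfolding adj by (intro tendsto_rmat tendsto_intros 1)
  then show ?thesis
    by (simp add: adjugate_mult case_prod_unfold)
qed

context fuchsian
begin

text \<open>A basic neighbourhood of the identity for pointwise convergence restricts the values at
  finitely many points only; discreteness lets one such neighbourhood isolate the identity.\<close>

lemma discrete:
  "\<exists>F U. finite F \<and> F \<subseteq> upper_half_plane \<and> (\<forall>z\<in>F. open (U z) \<and> z \<in> U z) \<and>
    (\<forall>g\<in>\<Delta>. (\<forall>z\<in>F. g z \<in> U z) \<longrightarrow> g = \<one>\<^bsub>G\<^esub>)"
proof -
  let ?P = "product_topology (\<lambda>_. top_of_set upper_half_plane) upper_half_plane"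
  have "openin (subtopology ?P \<Delta>) {\<one>\<^bsub>G\<^esub>}"
    using fuchsian one_closed by (simp add: fuchsian_group_def)
  then obtain T where T: "openin ?P T" "{\<one>\<^bsub>G\<^esub>} = T \<inter> \<Delta>"
    by (auto simp: openin_subtopology)
  then have "\<one>\<^bsub>G\<^esub> \<in> T" by blast
  with T(1) obtain U where U: "finite {z \<in> upper_half_plane. U z \<noteq> upper_half_plane}"
    "\<And>z. z \<in> upper_half_plane \<Longrightarrow> openin (top_of_set upper_half_plane) (U z)"
    "\<one>\<^bsub>G\<^esub> \<in> Pi\<^sub>E upper_half_plane U" "Pi\<^sub>E upper_half_plane U \<subseteq> T"
    unfolding openin_product_topology_alt by auto
  have H: "open upper_half_plane"
    unfolding upper_half_plane_def by (rule open_halfspace_Im_gt)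
  let ?F = "{z \<in> upper_half_plane. U z \<noteq> upper_half_plane}"
  show ?thesis
  proof (intro exI[of _ ?F] exI[of _ U] conjI ballI impI)
    fix z assume "z \<in> ?F"
    then have z: "z \<in> upper_half_plane" by simp
    have "\<one>\<^bsub>G\<^esub> z \<in> U z" using U(3) z by (rule PiE_mem)
    then show "open (U z)" "z \<in> U z"
      using U(2)[OF z] H z by (simp_all add: one_BijGroup openin_open_eq)
  next
    fix g assume g: "g \<in> \<Delta>" "\<forall>z\<in>?F. g z \<in> U z"
    then have "g z \<in> U z" if "z \<in> upper_half_plane" for z
      using maps_to[OF g(1) that] that by (cases "z \<in> ?F") auto
    then have "g \<in> Pi\<^sub>E upper_half_plane U"
      using Bij_imp_extensional[OF in_Bij[OF g(1)]] by (auto simp: PiE_def)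
    with U(4) g(1) T(2) show "g = \<one>\<^bsub>G\<^esub>" by blast
  qed (use U(1) in auto)
qed

text \<open>Infinitely many bounded matrices would accumulate at some L. The quotient of two
  distinct ones close to L acts almost as the identity, hence by discreteness as the identity, which
  makes the two isometries equal.\<close>

lemma finite_bounded:
  "finite {f \<in> \<Delta>. \<exists>A. realizes A f \<and> \<bar>det A\<bar> = 1 \<and> norm A \<le> M}" (is "finite ?S")
proof (rule ccontr)
  assume inf: "infinite ?S"
  obtain F U where FU: "finite F" "F \<subseteq> upper_half_plane" "\<forall>z\<in>F. open (U z) \<and> z \<in> U z"
    "\<forall>g\<in>\<Delta>. (\<forall>z\<in>F. g z \<in> U z) \<longrightarrow> g = \<one>\<^bsub>G\<^esub>"
    using discrete by blast
  define R where "R = (\<lambda>f. SOME A. realizes A f \<and> \<bar>det A\<bar> = 1 \<and> norm A \<le> M)"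
  have R: "realizes (R f) f" "\<bar>det (R f)\<bar> = 1" "norm (R f) \<le> M" if "f \<in> ?S" for f
    using that someI_ex[of "\<lambda>A. realizes A f \<and> \<bar>det A\<bar> = 1 \<and> norm A \<le> M"] unfolding R_def by auto
  have "inj_on R ?S"
  proof (rule inj_onI)
    fix f h assume fh: "f \<in> ?S" "h \<in> ?S" "R f = R h"
    show "f = h"
      using R(1)[OF fh(1)] R(1)[OF fh(2)] unfolding fh(3) by (rule realizes_inj)
  qed
  then have "infinite (R ` ?S)"
    using inf finite_imageD by blast
  moreover have "R ` ?S \<subseteq> cball 0 M"
  proof (rule image_subsetI)
    fix f assume "f \<in> ?S"
    from R(3)[OF this] show "R f \<in> cball 0 M" by simp
  qed
  ultimately obtain L where L: "L islimpt R ` ?S"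
    using compact_eq_Bolzano_Weierstrass[of "cball (0 :: real^2^2) M"] compact_cball by blast
  \<comment> \<open>L need not come from the group; it is invertible because the condition on the
    determinant is closed.\<close>
  have "closed {A :: real^2^2. \<bar>det A\<bar> = 1}"
    unfolding det_2 by (intro closed_Collect_eq continuous_intros)
  moreover have "L islimpt {A :: real^2^2. \<bar>det A\<bar> = 1}"
    using L by (rule islimpt_subset) (use R(2) in auto)
  ultimately have "\<bar>det L\<bar> = 1"
    unfolding closed_limpt by blast
  then have "det L \<noteq> 0" by auto
  have "eventually (\<lambda>C. \<forall>z\<in>F. mobius C z \<in> U z) (nhds (smat (det L)))"
    using FU(1-3) \<open>det L \<noteq> 0\<close> by (intro eventually_ball_finite ballI eventually_mobius_in_open) auto
  then have "eventually (\<lambda>x. \<forall>z\<in>F. mobius ((\<lambda>(A, B). adjugate A ** B) x) z \<in> U z) (nhds L \<times>\<^sub>F nhds L)"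
    using tendsto_adjugate_mult[of L] by (auto simp: filterlim_iff)
  then obtain Q where Q: "eventually Q (nhds L)"
    "\<And>A B z. Q A \<Longrightarrow> Q B \<Longrightarrow> z \<in> F \<Longrightarrow> mobius (adjugate A ** B) z \<in> U z"
    unfolding eventually_prod_same by auto
  then obtain T where T: "open T" "L \<in> T" "\<And>A. A \<in> T \<Longrightarrow> Q A"
    unfolding eventually_nhds by auto
  obtain A where A: "A \<in> R ` ?S" "A \<in> T" "A \<noteq> L"
    using islimptE[OF L T(2,1)] by blast
  \<comment> \<open>Removing A forces the second matrix to differ from the first, and A \<noteq> L
    keeps L in the neighbourhood.\<close>
  have T': "open (T - {A})" "L \<in> T - {A}"
    using T A(3) by auto
  obtain B where B: "B \<in> R ` ?S" "B \<in> T - {A}" "B \<noteq> L"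
    using islimptE[OF L T'(2,1)] by blast
  from A(1) B(1) obtain f h where fh: "f \<in> ?S" "h \<in> ?S" "A = R f" "B = R h" by auto
  have inv: "inv\<^bsub>G\<^esub> f \<in> \<Delta>"
    using inv_closed[of f] fh(1) by simp
  have g: "inv\<^bsub>G\<^esub> f \<otimes>\<^bsub>G\<^esub> h \<in> \<Delta>"
    using m_closed[of "inv\<^bsub>G\<^esub> f" h] inv fh(2) by simp
  have "realizes (adjugate A ** B) (inv\<^bsub>G\<^esub> f \<otimes>\<^bsub>G\<^esub> h)"
    unfolding fh(3,4) using fh(1,2)
    by (intro realizes_mult[OF inv] realizes_inv R(1)) auto
  then have "(inv\<^bsub>G\<^esub> f \<otimes>\<^bsub>G\<^esub> h) z = mobius (adjugate A ** B) z" if "z \<in> F" for z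
    using that FU(2) by (auto simp: realizes_def)
  then have "inv\<^bsub>G\<^esub> f \<otimes>\<^bsub>G\<^esub> h = \<one>\<^bsub>G\<^esub>"
    using Q(2)[OF T(3)[OF A(2)] T(3)[of B]] B(2) FU(4) g by simp
  then have "inv\<^bsub>G\<^esub> h = inv\<^bsub>G\<^esub> f"
    using inv_equality[of "inv\<^bsub>G\<^esub> f" h] fh(2) inv by simp
  then have "inv\<^bsub>G\<^esub> (inv\<^bsub>G\<^esub> h) = inv\<^bsub>G\<^esub> (inv\<^bsub>G\<^esub> f)"
    by simp
  then have "h = f"
    using inv_inv[of f] inv_inv[of h] fh(1,2) by simp
  with fh B(2) show False by simp
qed

end

subsection \<open>Infinitely many involutions\<close>

text \<open>Half turns about points at distance r compose to a translation by 2 r, with trace 2 cosh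
  r up to sign. Algebraically this is the reversed Cauchy-Schwarz inequality for timelike vectors,
  obtained from the inequality of arithmetic and geometric means applied twice.\<close>

lemma abs_trace_half_turns:
  assumes "det A = 1" "det B = 1" "trace A = 0" "trace B = 0"
  shows "\<bar>trace (A ** B :: real^2^2)\<bar> \<ge> 2"
proof (cases A; cases B)
  fix a b c d a' b' c' d'
  assume AB: "A = rmat a b c d" "B = rmat a' b' c' d'"
  then have d: "d = - a" "d' = - a'"
    using assms by auto
  then have bc: "b * c = - (1 + a\<^sup>2)" "b' * c' = - (1 + a'\<^sup>2)"
    using assms AB by (auto simp: power2_eq_square)
  have "(2 * (1 + \<bar>a * a'\<bar>))\<^sup>2 \<le> 4 * ((1 + a\<^sup>2) * (1 + a'\<^sup>2))"
  proof -
    have "0 \<le> (\<bar>a\<bar> - \<bar>a'\<bar>)\<^sup>2" by simp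
    then have "2 * \<bar>a * a'\<bar> \<le> a\<^sup>2 + a'\<^sup>2"
      by (simp add: power2_diff abs_mult)
    then show ?thesis
      by (simp add: power2_eq_square algebra_simps abs_mult)
  qed
  also have "\<dots> = 4 * ((b * c') * (c * b'))"
  proof -
    have "(b * c') * (c * b') = (b * c) * (b' * c')" by simp
    then show ?thesis unfolding bc by (simp add: algebra_simps)
  qed
  also have "\<dots> \<le> (b * c' + c * b')\<^sup>2"
    using zero_le_power2[of "b * c' - c * b'"] by (simp add: power2_eq_square algebra_simps)
  finally have "\<bar>2 * (1 + \<bar>a * a'\<bar>)\<bar> \<le> \<bar>b * c' + c * b'\<bar>"
    by (simp only: abs_le_square_iff)
  moreover have "trace (A ** B) = (b * c' + c * b') + 2 * (a * a')"
    by (simp add: AB d)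
  moreover have "\<bar>b * c' + c * b'\<bar> \<le> \<bar>trace (A ** B)\<bar> + 2 * \<bar>a * a'\<bar>"
    using abs_triangle_ineq4[of "trace (A ** B)" "2 * (a * a')"] calculation(2)
    by (simp add: abs_mult)
  ultimately show "\<bar>trace (A ** B)\<bar> \<ge> 2"
    by simp
qed

lemma norm_rmat_le: "norm (rmat a b c d) \<le> \<bar>a\<bar> + \<bar>b\<bar> + \<bar>c\<bar> + \<bar>d\<bar>"
proof -
  have "norm (rmat a b c d) \<le> (\<Sum>i\<in>UNIV. norm (rmat a b c d $ i))"
    unfolding norm_vec_def by (rule L2_set_le_sum) simp
  also have "\<dots> \<le> (\<Sum>i\<in>UNIV. \<Sum>j\<in>UNIV. \<bar>rmat a b c d $ i $ j\<bar>)"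
    by (intro sum_mono norm_le_l1_cart)
  finally show ?thesis by (simp add: sum_2)
qed

text \<open>In the Lorentzian space of traceless matrices with form \<open>tr (X Y)\<close>, two reflections with
  \<open>\<bar>tr (A\<^sub>1 A\<^sub>2)\<bar> < 2\<close> span a definite plane with timelike normal \<open>[A\<^sub>1, A\<^sub>2]\<close>, and a
  vector of norm 2 with bounded projection to the plane is bounded.\<close>

lemma bounded_by_two_reflections:
  assumes "det A1 = - 1" "trace A1 = 0" "det A2 = - 1" "trace A2 = 0" "\<bar>trace (A1 ** A2 :: real^2^2)\<bar> < 2"
  shows "\<exists>M. \<forall>A. det A = - 1 \<longrightarrow> trace A = 0 \<longrightarrow> \<bar>trace (A ** A1)\<bar> \<le> 2 \<longrightarrow> \<bar>trace (A ** A2)\<bar> \<le> 2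
    \<longrightarrow> norm A \<le> M"
proof (cases A1; cases A2)
  fix a1 b1 c1 d1 a2 b2 c2 d2
  assume A12: "A1 = rmat a1 b1 c1 d1" "A2 = rmat a2 b2 c2 d2"
  then have d: "d1 = - a1" "d2 = - a2"
    using assms by auto
  then have Q1: "a1\<^sup>2 + b1 * c1 = 1" and Q2: "a2\<^sup>2 + b2 * c2 = 1"
    using assms A12 by (auto simp: power2_eq_square)
  define T where "T = 2 * a1 * a2 + b1 * c2 + c1 * b2"
  have "\<bar>T\<bar> < 2"
    using assms(5) by (simp add: A12 d T_def algebra_simps)
  then have T: "4 - T\<^sup>2 > 0"
    using abs_square_less_1[of "T / 2"] by (simp add: power_divide)
  \<comment> \<open>The commutator of A1 and A2 is \<open>rmat na nb nc (- na)\<close>.\<close>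
  define na nb nc where "na = b1 * c2 - b2 * c1" and "nb = 2 * (a1 * b2 - a2 * b1)" and "nc = 2 * (c1 * a2 - a1 * c2)"
  \<comment> \<open>The weights 16, 16 and 8 bound 2 |2 P - S T|, 2 |2 S - P T| and |R|, the
    coefficients of A in the basis formed by A1, A2 and their commutator before division by 2 (4 -
    T^2).\<close>
  define \<beta> where "\<beta> = (\<lambda>u v n. (16 * \<bar>u\<bar> + 16 * \<bar>v\<bar> + 8 * \<bar>n\<bar>) / (2 * (4 - T\<^sup>2)))"
  have "norm A \<le> 2 * \<beta> a1 a2 na + \<beta> b1 b2 nb + \<beta> c1 c2 nc"
    if A: "det A = - 1" "trace A = 0" "\<bar>trace (A ** A1)\<bar> \<le> 2" "\<bar>trace (A ** A2)\<bar> \<le> 2" for A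
  proof (cases A)
    case (rmat a b c d)
    then have d3: "d = - a"
      using A(2) by simp
    then have Q: "a\<^sup>2 + b * c = 1"
      using A(1) rmat by (auto simp: power2_eq_square)
    define P S R where "P = 2 * a * a1 + b * c1 + c * b1" and "S = 2 * a * a2 + b * c2 + c * b2"
      and "R = 2 * a * na + b * nc + c * nb"
    have PS: "\<bar>P\<bar> \<le> 2" "\<bar>S\<bar> \<le> 2"
      using A(3,4) by (simp_all add: A12 rmat d d3 P_def S_def algebra_simps)
    \<comment> \<open>P, S and R are the traces of A times A1, A2 and the commutator. The square of
      R is -2 times the Gram determinant of A, A1, A2 for the form tr (X Y).\<close>
    have gram: "R\<^sup>2 = 4 * (P\<^sup>2 * (a2\<^sup>2 + b2 * c2) + S\<^sup>2 * (a1\<^sup>2 + b1 * c1) - P * S * T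
        - (a\<^sup>2 + b * c) * (4 * (a1\<^sup>2 + b1 * c1) * (a2\<^sup>2 + b2 * c2) - T\<^sup>2))"
      unfolding R_def P_def S_def T_def na_def nb_def nc_def power2_eq_square
      by (simp add: algebra_simps)
    have sq: "P\<^sup>2 \<le> 4" "S\<^sup>2 \<le> 4"
      using PS abs_le_square_iff[of P 2] abs_le_square_iff[of S 2] by auto
    have "\<bar>P * S\<bar> \<le> 2 * 2" "\<bar>S * T\<bar> \<le> 2 * 2" "\<bar>P * T\<bar> \<le> 2 * 2"
      unfolding abs_mult using PS \<open>\<bar>T\<bar> < 2\<close> by (intro mult_mono; simp)+
    moreover from this(1) have "\<bar>P * S * T\<bar> \<le> 4 * 2"
      unfolding abs_mult[of "P * S"] using \<open>\<bar>T\<bar> < 2\<close> by (intro mult_mono) auto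
    ultimately have prod: "\<bar>S * T\<bar> \<le> 4" "\<bar>P * T\<bar> \<le> 4" "\<bar>P * S * T\<bar> \<le> 8"
      by auto
    \<comment> \<open>4 (4 + 4 + 8) = 64, since the term subtracted last is 4 - T^2 > 0.\<close>
    have "R\<^sup>2 \<le> 8\<^sup>2"
      using gram sq prod(3) T unfolding Q Q1 Q2 by auto
    then have R: "\<bar>R\<bar> \<le> 8"
      using abs_le_square_iff[of R 8] by simp
    have bound: "\<bar>x\<bar> \<le> \<beta> u v n"
      if e: "2 * (4 - T\<^sup>2) * x = 2 * (2 * P - S * T) * u + 2 * (2 * S - P * T) * v - R * n" for x u v n
    proof -
      have "\<bar>2 * (2 * P - S * T) * u\<bar> \<le> 16 * \<bar>u\<bar>" "\<bar>2 * (2 * S - P * T) * v\<bar> \<le> 16 * \<bar>v\<bar>"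
        "\<bar>R * n\<bar> \<le> 8 * \<bar>n\<bar>"
        unfolding abs_mult[of _ u] abs_mult[of _ v] abs_mult[of _ n] using PS prod R
        by (intro mult_right_mono; simp)+
      then have "\<bar>2 * (4 - T\<^sup>2) * x\<bar> \<le> 16 * \<bar>u\<bar> + 16 * \<bar>v\<bar> + 8 * \<bar>n\<bar>"
        unfolding e by linarith
      then show ?thesis
        using T by (simp add: \<beta>_def abs_mult field_simps)
    qed
    \<comment> \<open>The expansion of A in the basis, entry by entry. The factors a1^2 + b1 c1 and
      a2^2 + b2 c2, equal to 1, are kept so that these are polynomial identities in free
      variables.\<close>
    have gen:
      "2 * (4 * (a1\<^sup>2 + b1 * c1) * (a2\<^sup>2 + b2 * c2) - T\<^sup>2) * a = 2 * (2 * P * (a2\<^sup>2 + b2 * c2) - S * T) * a1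
        + 2 * (2 * S * (a1\<^sup>2 + b1 * c1) - P * T) * a2 - R * na"
      "2 * (4 * (a1\<^sup>2 + b1 * c1) * (a2\<^sup>2 + b2 * c2) - T\<^sup>2) * b = 2 * (2 * P * (a2\<^sup>2 + b2 * c2) - S * T) * b1
        + 2 * (2 * S * (a1\<^sup>2 + b1 * c1) - P * T) * b2 - R * nb"
      "2 * (4 * (a1\<^sup>2 + b1 * c1) * (a2\<^sup>2 + b2 * c2) - T\<^sup>2) * c = 2 * (2 * P * (a2\<^sup>2 + b2 * c2) - S * T) * c1
        + 2 * (2 * S * (a1\<^sup>2 + b1 * c1) - P * T) * c2 - R * nc"
      unfolding R_def P_def S_def T_def na_def nb_def nc_def power2_eq_square
      by (simp_all add: algebra_simps)
    have "\<bar>a\<bar> \<le> \<beta> a1 a2 na" "\<bar>b\<bar> \<le> \<beta> b1 b2 nb" "\<bar>c\<bar> \<le> \<beta> c1 c2 nc"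
      using gen[unfolded Q1 Q2] by (intro bound; simp)+
    then show ?thesis
      using norm_rmat_le[of a b c d] unfolding rmat d3 by simp
  qed
  then show ?thesis by blast
qed

context fuchsian
begin

lemma not_Borel_property_if_infinite_involutions:
  assumes "infinite (involutions G)"
  shows "\<not> Borel_property G"
proof
  assume Borel: "Borel_property G"
  have crossing: "\<bar>trace (A ** B)\<bar> < 2"
    if "s \<in> involutions G" "t \<in> involutions G" "s \<noteq> t" "realizes A s" "realizes B t" "det A * det B = 1"
    for s t A B
    using not_Borel_property_if_trace[OF that] Borel by linarith
  define I where "I = (\<lambda>e. {s \<in> involutions G. \<exists>A. realizes A s \<and> det A = e})"
  have "s \<in> I 1 \<union> I (- 1)" if "s \<in> involutions G" for s
  proof -
    have "s \<in> \<Delta>" using that by (simp add: involutions_def)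
    then obtain A where "realizes A s" "\<bar>det A\<bar> = 1" by (rule realizable)
    moreover from this(2) have "det A = 1 \<or> det A = - 1" by linarith
    ultimately show ?thesis using that by (auto simp: I_def)
  qed
  moreover have "finite (I 1)"
  proof -
    have "s = t" if st: "s \<in> I 1" "t \<in> I 1" for s t
    proof (rule ccontr)
      assume "s \<noteq> t"
      obtain A B where AB: "realizes A s" "realizes B t" "det A = 1" "det B = 1"
        "s \<in> involutions G" "t \<in> involutions G"
        using st by (auto simp: I_def)
      have "\<bar>trace (A ** B)\<bar> < 2"
        using crossing[OF AB(5,6) \<open>s \<noteq> t\<close> AB(1,2)] AB(3,4) by simp
      moreover have "\<bar>trace (A ** B)\<bar> \<ge> 2"
        using AB by (intro abs_trace_half_turns involution_trace)
      ultimately show False by simp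
    qed
    then have "\<exists>s. I 1 \<subseteq> {s}" by blast
    then show ?thesis using finite_subset by blast
  qed
  moreover have "finite (I (- 1))"
  proof (rule ccontr)
    assume inf: "infinite (I (- 1))"
    then obtain s where s: "s \<in> I (- 1)"
      using infinite_imp_nonempty by blast
    moreover have "infinite (I (- 1) - {s})"
      using inf by simp
    then obtain t where t: "t \<in> I (- 1)" "s \<noteq> t"
      using infinite_imp_nonempty by blast
    ultimately obtain A1 A2 where A12: "realizes A1 s" "realizes A2 t" "det A1 = - 1" "det A2 = - 1"
      "s \<in> involutions G" "t \<in> involutions G"
      by (auto simp: I_def)
    have "\<bar>trace (A1 ** A2)\<bar> < 2"
      using crossing[OF A12(5,6) t(2) A12(1,2)] A12(3,4) by simp
    then obtain M where M: "\<And>A. det A = - 1 \<Longrightarrow> trace A = 0 \<Longrightarrow> \<bar>trace (A ** A1)\<bar> \<le> 2 \<Longrightarrow>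
        \<bar>trace (A ** A2)\<bar> \<le> 2 \<Longrightarrow> norm A \<le> M"
      using bounded_by_two_reflections[OF A12(3) involution_trace[OF A12(5,1)] A12(4) involution_trace[OF A12(6,2)]]
      by blast
    \<comment> \<open>The bound is weak because u may coincide with one of the two fixed
      reflections; then A = B or A = - B, and the trace is 2 or -2.\<close>
    have le: "\<bar>trace (A ** B)\<bar> \<le> 2"
      if uv: "u \<in> involutions G" "v \<in> involutions G" "realizes A u" "realizes B v" "det A = - 1" "det B = - 1" for u v A B
    proof (cases "u = v")
      case True
      then obtain k where k: "k \<noteq> 0" "A = k *\<^sub>R B"
        using realizes_unique uv(3,4) by blast
      then have "k\<^sup>2 = 1"
        using uv(5,6) by (simp add: det_scaleR_2)
      then have "\<bar>k\<bar> = 1" by (simp add: power2_eq_1_iff abs_if split: if_splits) linarith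
      have "trace (B ** B) = 2"
      proof (cases B)
        case (rmat a b c d)
        then have "d = - a" using involution_trace[OF uv(2,4)] by simp
        with rmat uv(6) show ?thesis by simp
      qed
      moreover have "trace (A ** B) = k * trace (B ** B)"
        unfolding k(2) by (cases B) (simp add: algebra_simps)
      ultimately show ?thesis
        using \<open>\<bar>k\<bar> = 1\<close> by (simp add: abs_mult)
    next
      case False
      then show ?thesis
        using crossing[OF uv(1,2) _ uv(3,4)] uv(5,6) by fastforce
    qed
    have "I (- 1) \<subseteq> {f \<in> \<Delta>. \<exists>A. realizes A f \<and> \<bar>det A\<bar> = 1 \<and> norm A \<le> M}"
    proof
      fix u assume "u \<in> I (- 1)"
      then obtain A where A: "u \<in> involutions G" "realizes A u" "det A = - 1"
        by (auto simp: I_def)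
      have "norm A \<le> M"
        using A(3) involution_trace[OF A(1,2)] le[OF A(1) A12(5) A(2) A12(1) A(3) A12(3)]
          le[OF A(1) A12(6) A(2) A12(2) A(3) A12(4)] by (rule M)
      moreover have "u \<in> \<Delta>" using A(1) by (simp add: involutions_def)
      ultimately show "u \<in> {f \<in> \<Delta>. \<exists>A. realizes A f \<and> \<bar>det A\<bar> = 1 \<and> norm A \<le> M}"
        using A(2,3) by auto
    qed
    with inf finite_bounded show False
      using finite_subset by blast
  qed
  ultimately show False
    using assms finite_subset[of "involutions G" "I 1 \<union> I (- 1)"] by blast
qed

end

subsection \<open>Finitely many involutions\<close>

text \<open>The counting half of the orbit-stabilizer theorem for an arbitrary map \<phi>: each
  fibre of \<phi> lies in a single right coset.\<close>

lemma (in group) finite_rcosets_if_finite_image: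
  assumes "subgroup H G" "finite (\<phi> ` carrier G)"
    and "\<And>g h. g \<in> carrier G \<Longrightarrow> h \<in> carrier G \<Longrightarrow> \<phi> g = \<phi> h \<Longrightarrow> g \<otimes> inv h \<in> H"
  shows "finite (rcosets H)"
proof -
  let ?r = "\<lambda>v. SOME g. g \<in> carrier G \<and> \<phi> g = v"
  have "rcosets H \<subseteq> (\<lambda>v. H #> ?r v) ` \<phi> ` carrier G"
  proof
    fix C assume "C \<in> rcosets H"
    then obtain g where g: "g \<in> carrier G" "C = H #> g"
      by (auto simp: RCOSETS_def)
    have r: "?r (\<phi> g) \<in> carrier G \<and> \<phi> (?r (\<phi> g)) = \<phi> g"
      by (rule someI[of _ g]) (use g in simp)
    then have "?r (\<phi> g) \<otimes> inv g \<in> H"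
      using assms(3) g(1) by blast
    then have "?r (\<phi> g) \<in> H #> g"
      using r g(1) subgroup.subset[OF assms(1)]
      by (auto simp: r_coset_def m_assoc intro!: bexI[of _ "?r (\<phi> g) \<otimes> inv g"])
    then have "C = H #> ?r (\<phi> g)"
      using repr_independence[OF _ g(1) assms(1)] g(2) by simp
    then show "C \<in> (\<lambda>v. H #> ?r v) ` \<phi> ` carrier G"
      using g(1) by blast
  qed
  then show ?thesis
    using assms(2) finite_subset by blast
qed

lemma (in group) conj_involution:
  assumes "s \<in> involutions G" "g \<in> carrier G"
  shows "inv g \<otimes> s \<otimes> g \<in> involutions G"
proof -
  have s: "s \<in> carrier G" "s \<noteq> \<one>" "s \<otimes> s = \<one>"
    using assms(1) involutions_iff by auto
  have "inv g \<otimes> s \<otimes> g \<otimes> (inv g \<otimes> s \<otimes> g) = inv g \<otimes> (s \<otimes> (g \<otimes> inv g) \<otimes> s) \<otimes> g"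
    using s(1) assms(2) by (simp only: m_assoc m_closed inv_closed)
  also have "\<dots> = \<one>"
    using s assms(2) by simp
  finally have "inv g \<otimes> s \<otimes> g \<otimes> (inv g \<otimes> s \<otimes> g) = \<one>" .
  moreover have "inv g \<otimes> s \<otimes> g \<noteq> \<one>"
  proof
    assume "inv g \<otimes> s \<otimes> g = \<one>"
    then have "g \<otimes> (inv g \<otimes> s \<otimes> g) \<otimes> inv g = \<one>"
      using assms(2) by simp
    moreover have "g \<otimes> (inv g \<otimes> s \<otimes> g) \<otimes> inv g = g \<otimes> inv g \<otimes> s \<otimes> (g \<otimes> inv g)"
      using s(1) assms(2) by (simp only: m_assoc m_closed inv_closed)
    ultimately have "s = \<one>"
      using s(1) assms(2) by simp
    with s(2) show False by simp
  qed
  ultimately show ?thesis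
    using s(1) assms(2) by (simp add: involutions_iff)
qed

lemma (in group) conj_eq_imp_commute:
  assumes "s \<in> carrier G" "g \<in> carrier G" "h \<in> carrier G"
    and "inv g \<otimes> s \<otimes> g = inv h \<otimes> s \<otimes> h"
  shows "s \<otimes> (g \<otimes> inv h) = g \<otimes> inv h \<otimes> s"
proof -
  have "s \<otimes> (g \<otimes> inv h) = g \<otimes> inv g \<otimes> s \<otimes> g \<otimes> inv h"
    using assms(1-3) by (simp add: m_assoc)
  also have "\<dots> = g \<otimes> (inv g \<otimes> s \<otimes> g) \<otimes> inv h"
    using assms(1-3) by (simp only: m_assoc m_closed inv_closed)
  also have "\<dots> = g \<otimes> inv h \<otimes> s \<otimes> (h \<otimes> inv h)"
    unfolding assms(4) using assms(1-3) by (simp only: m_assoc m_closed inv_closed)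
  finally show ?thesis
    using assms(1-3) by simp
qed

lemma (in group) mult_inv_cancel_right:
  "g \<in> carrier G \<Longrightarrow> h \<in> carrier G \<Longrightarrow> g \<otimes> inv h \<otimes> h = g"
  by (simp add: m_assoc)

text \<open>A traceless invertible matrix is not scalar, and a matrix commuting with a nonscalar
  matrix of size two is a polynomial in it.\<close>

lemma commuting_traceless:
  assumes "trace A = 0" "det A \<noteq> 0" "B ** A = A ** (B :: real^2^2)"
  shows "\<exists>x y. B = smat x + y *\<^sub>R A"
proof (cases A; cases B)
  fix a b c d e f g h
  assume AB: "A = rmat a b c d" "B = rmat e f g h"
  then have d: "d = - a" using assms(1) by simp
  have n: "b * c \<noteq> - (a * a)" using assms(2) AB d by auto
  have e: "f * c = b * g" "e * b - f * a = a * f + b * h" "g * a + h * c = c * e - a * g"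
    using assms(3) by (simp_all add: AB d)
  \<comment> \<open>In B = x + y A one has g = y c, f = y b and e - h = 2 y a; y is read off from a
    nonzero entry of A, and a \<noteq> 0 if b = c = 0, by invertibility.\<close>
  define y where "y = (if c \<noteq> 0 then g / c else if b \<noteq> 0 then f / b else (e - h) / (2 * a))"
  have "f = y * b" "g = y * c" "e - h = 2 * (y * a)"
    using e n by (auto simp: y_def field_simps)
  moreover from this(3) have "h = e - 2 * (y * a)" by simp
  ultimately have "B = smat (e - y * a) + y *\<^sub>R A"
    by (simp add: AB d)
  then show ?thesis by blast
qed

lemma matrix_conj_eq_imp_commute:
  fixes A B C :: "real^2^2"
  assumes "det B \<noteq> 0" "det C \<noteq> 0"
    and "(1 / det B) *\<^sub>R (adjugate B ** A ** B) = (1 / det C) *\<^sub>R (adjugate C ** A ** C)"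
  shows "(B ** adjugate C) ** A = A ** (B ** adjugate C)"
proof -
  have smat_mult: "smat k ** D = k *\<^sub>R D" "D ** smat k = k *\<^sub>R D" for k D
    by (cases D; simp add: mult.commute)+
  have "B ** ((1 / det B) *\<^sub>R (adjugate B ** A ** B)) ** adjugate C
      = (1 / det B) *\<^sub>R ((B ** adjugate B) ** A ** (B ** adjugate C))"
    by (simp add: matrix_mul_assoc matrix_scalar_ac flip: scalar_matrix_assoc)
  moreover have "B ** ((1 / det C) *\<^sub>R (adjugate C ** A ** C)) ** adjugate C
      = (1 / det C) *\<^sub>R ((B ** adjugate C) ** A ** (C ** adjugate C))"
    by (simp add: matrix_mul_assoc matrix_scalar_ac flip: scalar_matrix_assoc)
  ultimately show ?thesis
    using assms by (simp add: adjugate_mult smat_mult matrix_scalar_ac flip: scalar_matrix_assoc)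
qed

context fuchsian
begin

text \<open>The centralizer of a traceless matrix in the matrix algebra is commutative, and it meets
  the group in a subgroup of finite index, since the orbit of the matrix under conjugation
  is finite.\<close>

lemma virtually_abelian_if_finite_involutions:
  assumes "finite (involutions G)" "involutions G \<noteq> {}"
  shows "virtually_abelian G"
proof -
  obtain s where s: "s \<in> involutions G" using assms(2) by blast
  then have s\<Delta>: "s \<in> \<Delta>" by (simp add: involutions_def)
  obtain A where A: "realizes A s" "\<bar>det A\<bar> = 1"
    using realizable[OF s\<Delta>] by blast
  have trA: "trace A = 0" and detA: "det A \<noteq> 0"
    using involution_trace[OF s A(1)] A(2) by auto
  define H where "H = {g \<in> \<Delta>. \<exists>x y. realizes (smat x + y *\<^sub>R A) g}"
  have poly_mult: "(smat x + y *\<^sub>R A) ** (smat x' + y' *\<^sub>R A)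
      = smat (x * x' - y * y' * det A) + (x * y' + x' * y) *\<^sub>R A" for x y x' y'
  proof (cases A)
    case (rmat a b c d)
    with trA have "d = - a" by simp
    then show ?thesis by (simp add: rmat algebra_simps)
  qed
  have adj: "adjugate (smat x + y *\<^sub>R A) = smat x + (- y) *\<^sub>R A" for x y
  proof (cases A)
    case (rmat a b c d)
    with trA have "d = - a" by simp
    then show ?thesis by (simp add: rmat)
  qed
  have H\<Delta>: "H \<subseteq> \<Delta>" by (auto simp: H_def)
  have H: "subgroup H G"
  proof (rule subgroupI)
    show "H \<subseteq> carrier G" using H\<Delta> by simp
    have "realizes (smat 1 + 0 *\<^sub>R A) \<one>\<^bsub>G\<^esub>"
      using realizes_one_iff by (cases A) simp
    moreover have "\<one>\<^bsub>G\<^esub> \<in> \<Delta>" using one_closed by simp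
    ultimately have "\<one>\<^bsub>G\<^esub> \<in> H" unfolding H_def by blast
    then show "H \<noteq> {}" by blast
  next
    fix g assume "g \<in> H"
    then obtain x y where g: "g \<in> \<Delta>" "realizes (smat x + y *\<^sub>R A) g"
      by (auto simp: H_def)
    have "realizes (smat x + (- y) *\<^sub>R A) (inv\<^bsub>G\<^esub> g)"
      using realizes_inv[OF g] unfolding adj .
    moreover have "inv\<^bsub>G\<^esub> g \<in> \<Delta>" using inv_closed[of g] g(1) by simp
    ultimately show "inv\<^bsub>G\<^esub> g \<in> H" unfolding H_def by blast
  next
    fix g h assume "g \<in> H" "h \<in> H"
    then obtain x y x' y' where g: "g \<in> \<Delta>" "realizes (smat x + y *\<^sub>R A) g"
      and h: "h \<in> \<Delta>" "realizes (smat x' + y' *\<^sub>R A) h"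
      by (auto simp: H_def)
    have "g \<otimes>\<^bsub>G\<^esub> h \<in> \<Delta>" using m_closed[of g h] g(1) h(1) by simp
    with realizes_mult[OF g(1) h(1) g(2) h(2), unfolded poly_mult]
    show "g \<otimes>\<^bsub>G\<^esub> h \<in> H" unfolding H_def by blast
  qed
  have comm: "g \<otimes>\<^bsub>G\<^esub> h = h \<otimes>\<^bsub>G\<^esub> g" if "g \<in> H" "h \<in> H" for g h
  proof -
    from that obtain x y x' y' where g: "g \<in> \<Delta>" "realizes (smat x + y *\<^sub>R A) g"
      and h: "h \<in> \<Delta>" "realizes (smat x' + y' *\<^sub>R A) h"
      by (auto simp: H_def)
    have "(smat x' + y' *\<^sub>R A) ** (smat x + y *\<^sub>R A) = (smat x + y *\<^sub>R A) ** (smat x' + y' *\<^sub>R A)"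
      unfolding poly_mult by (simp only: mult.commute add.commute)
    from realizes_mult[OF h(1) g(1) h(2) g(2), unfolded this]
    show ?thesis
      by (rule realizes_inj[OF realizes_mult[OF g(1) h(1) g(2) h(2)]])
  qed
  define R where "R = (\<lambda>g. SOME B. realizes B g \<and> \<bar>det B\<bar> = 1)"
  have R: "realizes (R g) g" "\<bar>det (R g)\<bar> = 1" if "g \<in> \<Delta>" for g
  proof -
    have "\<exists>B. realizes B g \<and> \<bar>det B\<bar> = 1"
      by (rule realizable[OF that]) blast
    from someI_ex[OF this] show "realizes (R g) g" "\<bar>det (R g)\<bar> = 1"
      unfolding R_def by auto
  qed
  have R0: "det (R g) \<noteq> 0" if "g \<in> \<Delta>" for g
    using R(2)[OF that] by auto
  \<comment> \<open>\<phi> records the conjugated matrix and not just the conjugated isometry: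
    commuting isometries only have matrices that commute up to sign, whereas equal values of \<phi>
    give exact commutation with A. The price is two possible values for each involution.\<close>
  define \<phi> where "\<phi> = (\<lambda>g. (1 / det (R g)) *\<^sub>R (adjugate (R g) ** A ** R g))"
  have "finite (\<phi> ` \<Delta>)"
  proof (rule finite_subset)
    show "\<phi> ` \<Delta> \<subseteq> (\<Union>t\<in>involutions G. {R t, - R t})"
    proof (rule image_subsetI)
      fix g assume g: "g \<in> \<Delta>"
      let ?t = "inv\<^bsub>G\<^esub> g \<otimes>\<^bsub>G\<^esub> s \<otimes>\<^bsub>G\<^esub> g"
      have inv: "inv\<^bsub>G\<^esub> g \<in> \<Delta>" using inv_closed[of g] g by simp
      have "inv\<^bsub>G\<^esub> g \<otimes>\<^bsub>G\<^esub> s \<in> \<Delta>" using m_closed[of "inv\<^bsub>G\<^esub> g" s] inv s\<Delta> by simp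
      then have "realizes (adjugate (R g) ** A ** R g) ?t"
        by (intro realizes_mult realizes_inv inv s\<Delta> g R A)
      then have \<phi>: "realizes (\<phi> g) ?t"
        unfolding \<phi>_def using R0[OF g] by (intro realizes_scaleR) auto
      have t: "?t \<in> involutions G"
        using conj_involution[OF s, of g] g by simp
      then have t\<Delta>: "?t \<in> \<Delta>" by (simp add: involutions_def)
      obtain k where k: "\<phi> g = k *\<^sub>R R ?t"
        using realizes_unique[OF \<phi> R(1)[OF t\<Delta>]] by blast
      have "\<bar>det (\<phi> g)\<bar> = 1"
        using R(2)[OF g] A(2) by (simp add: \<phi>_def det_scaleR_2 det_mul abs_mult power_divide flip: power2_abs[of "det (R g)"])
      then have "k\<^sup>2 = 1"
        using R(2)[OF t\<Delta>] unfolding k by (simp add: det_scaleR_2 abs_mult)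
      then have "k = 1 \<or> k = - 1" by (simp add: power2_eq_1_iff)
      then have "\<phi> g \<in> {R ?t, - R ?t}" using k by auto
      with t show "\<phi> g \<in> (\<Union>t\<in>involutions G. {R t, - R t})" by blast
    qed
  qed (use assms(1) in simp)
  then have "finite (rcosets\<^bsub>G\<^esub> H)"
  proof (intro finite_rcosets_if_finite_image[OF H, of \<phi>])
    fix g h assume "g \<in> carrier G" "h \<in> carrier G" and eq: "\<phi> g = \<phi> h"
    then have gh: "g \<in> \<Delta>" "h \<in> \<Delta>" by simp_all
    have inv: "inv\<^bsub>G\<^esub> h \<in> \<Delta>" using inv_closed[of h] gh by simp
    have "(R g ** adjugate (R h)) ** A = A ** (R g ** adjugate (R h))"
      using eq gh R0 unfolding \<phi>_def by (intro matrix_conj_eq_imp_commute)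
    then obtain x y where "R g ** adjugate (R h) = smat x + y *\<^sub>R A"
      using commuting_traceless[OF trA detA] by blast
    moreover have "realizes (R g ** adjugate (R h)) (g \<otimes>\<^bsub>G\<^esub> inv\<^bsub>G\<^esub> h)"
      by (intro realizes_mult realizes_inv inv gh R)
    moreover have "g \<otimes>\<^bsub>G\<^esub> inv\<^bsub>G\<^esub> h \<in> \<Delta>"
      using m_closed[of g "inv\<^bsub>G\<^esub> h"] gh inv by simp
    ultimately show "g \<otimes>\<^bsub>G\<^esub> inv\<^bsub>G\<^esub> h \<in> H"
      unfolding H_def by auto
  qed simp
  moreover have "comm_group (G\<lparr>carrier := H\<rparr>)"
    using group.group_comm_groupI[OF subgroup_imp_group[OF H]] comm by simp
  ultimately show ?thesis
    using H unfolding virtually_abelian_def by blast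
qed

end

subsection \<open>Elliptic points of order two\<close>

text \<open>The map is a holomorphic fraction after conjugation, so its derivative is \<mu> times
  \<open>cnj\<close>, with Jacobian - |\<mu>|^2.\<close>

lemma has_derivative_orientation_reversing:
  assumes "det A < 0" "p \<in> upper_half_plane" "(mobius A has_derivative D) (at p)"
  shows "Re (D 1) * Im (D \<i>) - Re (D \<i>) * Im (D 1) \<le> 0"
proof (cases A)
  case (rmat a b c d)
  let ?F = "\<lambda>w. (of_real a * w + of_real b) / (of_real c * w + of_real d) :: complex"
  have "of_real c * cnj p + of_real d \<noteq> 0"
    using assms(1,2) rmat by (intro mobius_denominator_nonzero[of a d b c]) (auto simp: upper_half_plane_def)
  then have "?F field_differentiable (at (cnj p))"
    by (intro derivative_intros)
  then obtain \<mu> where "(?F has_field_derivative \<mu>) (at (cnj p))"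
    by (auto simp: field_differentiable_def)
  then have "(?F has_derivative (*) \<mu>) (at (cnj p))"
    by (simp add: has_field_derivative_def)
  moreover have "(cnj has_derivative cnj) (at p)"
    by (rule bounded_linear_imp_has_derivative[OF bounded_linear_cnj])
  ultimately have "(?F \<circ> cnj has_derivative (*) \<mu> \<circ> cnj) (at p)"
    by (intro diff_chain_at)
  moreover have "?F \<circ> cnj = mobius A"
    using assms(1) by (simp add: mobius_def rmat fun_eq_iff Let_def)
  ultimately have "D = (*) \<mu> \<circ> cnj"
    using has_derivative_unique[OF assms(3)] by simp
  then have "Re (D 1) * Im (D \<i>) - Re (D \<i>) * Im (D 1) = - ((Re \<mu>)\<^sup>2 + (Im \<mu>)\<^sup>2)"
    by (simp add: power2_eq_square)
  then show ?thesis by simp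
qed

text \<open>Fixed points solve c z^2 - 2 a z - b = 0, a real quadratic with discriminant - 4 det A <
  0; of its two conjugate roots only one lies in the upper half plane.\<close>

lemma half_turn_fixed_point_unique:
  assumes "det A > 0" "trace A = 0" "p \<in> upper_half_plane" "q \<in> upper_half_plane"
    and "mobius A p = p" "mobius A q = q"
  shows "p = q"
proof (cases A)
  case (rmat a b c d)
  then have d: "d = - a" using assms(2) by simp
  then have det: "- (a * a) - b * c > 0" using assms(1) rmat by simp
  have "c \<noteq> 0" using det by auto
  have xy: "Re z = a / c \<and> (Im z)\<^sup>2 = - (a * a + b * c) / c\<^sup>2"
    if "z \<in> upper_half_plane" "mobius A z = z" for z
  proof -
    have y: "Im z > 0" using that by (simp add: upper_half_plane_def)
    have "of_real c * z + of_real d \<noteq> 0"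
      using assms(1) rmat y by (intro mobius_denominator_nonzero[of a d b c]) auto
    then have "of_real a * z + of_real b = z * (of_real c * z + of_real d)"
      using that(2) assms(1) by (simp add: mobius_def rmat nonzero_divide_eq_eq)
    then have im: "a * Im z = Im z * (2 * c * Re z - a)" and re: "a * Re z + b = c * ((Re z)\<^sup>2 - (Im z)\<^sup>2) - a * Re z"
      by (auto simp: complex_eq_iff d power2_eq_square algebra_simps)
    from im y have x: "c * Re z = a" by (simp add: mult.commute[of a])
    have "c * (a * Re z + b) = (c * Re z)\<^sup>2 - c\<^sup>2 * (Im z)\<^sup>2 - a * (c * Re z)"
      unfolding re by (simp add: power2_eq_square algebra_simps)
    then have "c\<^sup>2 * (Im z)\<^sup>2 = - (a * a + b * c)"
      using x by (simp add: power2_eq_square algebra_simps)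
    with x \<open>c \<noteq> 0\<close> show ?thesis
      by (simp add: field_simps)
  qed
  have "(Im p)\<^sup>2 = (Im q)\<^sup>2" "Re p = Re q"
    using xy[OF assms(3,5)] xy[OF assms(4,6)] by simp_all
  moreover have "Im p > 0" "Im q > 0"
    using assms(3,4) by (simp_all add: upper_half_plane_def)
  ultimately show ?thesis
    by (simp add: complex_eq_iff power2_eq_iff_nonneg)
qed

context fuchsian
begin

text \<open>Whatever commutes with the half turn s about p maps p to a fixed point of s, hence to p,
  and so lies in the stabilizer of order two. Each conjugate of s thus arises from at most two
  elements, and finitely many conjugates would make \<Delta> finite.\<close>

lemma infinite_involutions_if_elliptic:
  assumes "oriented \<Delta>" "infinite \<Delta>" "elliptic_point_of_order 2 \<Delta> p"
  shows "infinite (involutions G)"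
proof
  assume fin: "finite (involutions G)"
  let ?S = "{g \<in> \<Delta>. g p = p}"
  have p: "p \<in> upper_half_plane" and card: "card ?S = 2"
    using assms(3) by (simp_all add: elliptic_point_of_order_def stabilizer_def)
  have one: "\<one>\<^bsub>G\<^esub> \<in> ?S"
    using one_closed one_apply[OF p] by simp
  have "\<exists>s. T = {e, s} \<and> s \<noteq> e" if "card T = 2" "e \<in> T" for T and e :: "complex \<Rightarrow> complex"
    using that by (auto simp: card_2_iff)
  from this[OF card one] obtain s where S: "?S = {\<one>\<^bsub>G\<^esub>, s}" "s \<noteq> \<one>\<^bsub>G\<^esub>"
    by blast
  then have s: "s \<in> \<Delta>" "s p = p" by blast+
  have "s \<otimes>\<^bsub>G\<^esub> s \<in> ?S"
    using m_closed[of s s] s mult_apply[OF s(1) s(1) p] by simp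
  moreover have "s \<otimes>\<^bsub>G\<^esub> s \<noteq> s"
    using S(2) l_cancel_one[of s s] s(1) by auto
  ultimately have "s \<otimes>\<^bsub>G\<^esub> s = \<one>\<^bsub>G\<^esub>"
    unfolding S(1) by blast
  then have inv: "s \<in> involutions G"
    using s(1) S(2) by (simp add: involutions_iff)
  obtain A where A: "realizes A s"
    using realizable[OF s(1)] by blast
  \<comment> \<open>Orientation excludes that the stabilizer is generated by a reflection, whose
    fixed points fill a whole geodesic.\<close>
  have "det A > 0"
  proof (rule ccontr)
    assume "\<not> det A > 0"
    with A have neg: "det A < 0" by (simp add: realizes_def)
    obtain D where D: "(s has_derivative D) (at p)" "Re (D 1) * Im (D \<i>) - Re (D \<i>) * Im (D 1) > 0"
      using assms(1) s(1) p by (auto simp: oriented_def orientation_preserving_def)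
    have "(mobius A has_derivative D) (at p)"
      using D(1)
    proof (rule has_derivative_transform_within_open)
      show "open upper_half_plane"
        unfolding upper_half_plane_def by (rule open_halfspace_Im_gt)
    qed (use A p in \<open>auto simp: realizes_def\<close>)
    from has_derivative_orientation_reversing[OF neg p this] D(2) show False by simp
  qed
  then have unique: "q = p" if "q \<in> upper_half_plane" "s q = q" for q
    using half_turn_fixed_point_unique[of A q p] involution_trace[OF inv A] that p s(2) A
    by (simp add: realizes_def)
  let ?\<psi> = "\<lambda>g. inv\<^bsub>G\<^esub> g \<otimes>\<^bsub>G\<^esub> s \<otimes>\<^bsub>G\<^esub> g"
  have "finite (?\<psi> -` involutions G \<inter> \<Delta>)"
  proof (rule finite_finite_vimage_IntI[OF fin])
    fix t
    show "finite (?\<psi> -` {t} \<inter> \<Delta>)"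
    proof (cases "?\<psi> -` {t} \<inter> \<Delta> = {}")
      case False
      then obtain h where h: "h \<in> \<Delta>" "?\<psi> h = t" by blast
      have "?\<psi> -` {t} \<inter> \<Delta> \<subseteq> (\<lambda>k. k \<otimes>\<^bsub>G\<^esub> h) ` ?S"
      proof
        fix g assume "g \<in> ?\<psi> -` {t} \<inter> \<Delta>"
        then have g: "g \<in> \<Delta>" "?\<psi> g = ?\<psi> h" using h by auto
        let ?k = "g \<otimes>\<^bsub>G\<^esub> inv\<^bsub>G\<^esub> h"
        have c: "g \<in> carrier G" "h \<in> carrier G" "s \<in> carrier G" "inv\<^bsub>G\<^esub> g \<in> carrier G" "inv\<^bsub>G\<^esub> h \<in> carrier G"
          using g h s inv_closed by auto
        have k: "?k \<in> \<Delta>" using m_closed[OF c(1,5)] by simp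
        have "s \<otimes>\<^bsub>G\<^esub> ?k = ?k \<otimes>\<^bsub>G\<^esub> s"
          by (rule conj_eq_imp_commute[OF c(3,1,2) g(2)])
        then have "(s \<otimes>\<^bsub>G\<^esub> ?k) p = (?k \<otimes>\<^bsub>G\<^esub> s) p"
          by simp
        then have "s (?k p) = ?k p"
          using mult_apply[OF s(1) k p] mult_apply[OF k s(1) p] s(2) by simp
        then have "?k \<in> ?S"
          using unique maps_to[OF k p] k by blast
        moreover have "g = ?k \<otimes>\<^bsub>G\<^esub> h"
          using mult_inv_cancel_right[OF c(1,2)] by (rule sym)
        ultimately show "g \<in> (\<lambda>k. k \<otimes>\<^bsub>G\<^esub> h) ` ?S" by blast
      qed
      \<comment> \<open>\<open>card ?S = 2\<close> also yields finiteness, since infinite sets have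
        \<open>card\<close> 0.\<close>
      then show ?thesis
        using card finite_subset by (metis (no_types, lifting) card.infinite finite_imageI zero_neq_numeral)
    qed simp
  qed
  moreover have "\<Delta> \<subseteq> ?\<psi> -` involutions G \<inter> \<Delta>"
    using conj_involution[OF inv] by auto
  ultimately show False
    using assms(2) finite_subset by blast
qed

end

text \<open>The hypotheses exclude degenerate cases. An infinite elementary abelian 2-group has
  infinitely many involutions but no element of infinite order, so Borel's property holds vacuously;
  the same goes for the Fuchsian groups of order two generated by a reflection or by a half turn. A
  torsion-free non-orientable surface group has no involution. The non-oriented clause is the
  contrapositive of virtual commutativity under finitely many involutions.\<close>

theorem theorem1p6:
  fixes \<Gamma> :: "('a, 'b) monoid_scheme"
    and \<Delta> :: "(complex \<Rightarrow> complex) set"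
  shows "\<not> Borel_property infinite_dihedral_group
    \<and> (group \<Gamma> \<and> (\<exists>H. subgroup H \<Gamma> \<and> infinite_dihedral_group \<cong> \<Gamma>\<lparr>carrier := H\<rparr>)
         \<longrightarrow> \<not> Borel_property \<Gamma>)
    \<and> (group \<Gamma> \<and> virtually_torsion_free \<Gamma> \<and> infinite (involutions \<Gamma>)
         \<longrightarrow> \<not> Borel_property \<Gamma>)
    \<and> (fuchsian_group \<Delta> \<and> infinite (involutions (isometry_group \<Delta>))
         \<longrightarrow> \<not> Borel_property (isometry_group \<Delta>))
    \<and> (fuchsian_group \<Delta> \<and> \<not> oriented \<Delta> \<and> \<not> virtually_abelian (isometry_group \<Delta>)
         \<and> involutions (isometry_group \<Delta>) \<noteq> {}
         \<longrightarrow> infinite (involutions (isometry_group \<Delta>)) \<and> \<not> Borel_property (isometry_group \<Delta>))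
    \<and> (fuchsian_group \<Delta> \<and> oriented \<Delta> \<and> infinite \<Delta> \<and> (\<exists>p. elliptic_point_of_order 2 \<Delta> p)
         \<longrightarrow> infinite (involutions (isometry_group \<Delta>)) \<and> \<not> Borel_property (isometry_group \<Delta>))"
  using not_Borel_property_infinite_dihedral_group not_Borel_property_if_dihedral_subgroup[of \<Gamma>]
    not_Borel_property_if_infinitely_many_involutions[of \<Gamma>]
    fuchsian.not_Borel_property_if_infinite_involutions[of \<Delta>]
    fuchsian.virtually_abelian_if_finite_involutions[of \<Delta>]
    fuchsian.infinite_involutions_if_elliptic[of \<Delta>]
  unfolding fuchsian_def by blast

end
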